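(* Let $L$ be a Leibniz algebra over a field $\mathbb{F}$ and let $0\to R\to F\to L\to 0$ be a free presentation of $L$. Then \[\mathcal{H}^2(L,\mathbb{F})\cong\frac{F'\cap R}{FR+RF}.\] In particular, if $L$ is finite-dimensional, then $M(L)\cong\mathcal{H}^2(L,\mathbb{F})$.
   Context: A (left) Leibniz algebra over a field $\mathbb{F}$ is an $\mathbb{F}$-vector space with a bilinear multiplication satisfying $x(yz)=(xy)z+y(xz)$. $L'$ is the span of all products in $L$, and $Z(L)=\{z\in L: zx=xz=0\ \forall x\in L\}$. A free presentation $0\to R\to F\to L\to 0$ is a short exact sequence of Leibniz algebras with $F$ a free Leibniz algebra, $R$ regarded as an ideal of $F$; $FR$ and $RF$ denote the spans of products $xr$ and $rx$ respectively ($x\in F$, $r\in R$). $\mathcal{H}^2(L,\mathbb{F})=\mathcal{Z}^2(L,\mathbb{F})/\mathcal{B}^2(L,\mathbb{F})$, where $\mathbb{F}$ is a central (trivial) module, $\mathcal{Z}^2(L,\mathbb{F})$ is the space of bilinear forms $f:L\times L\to\mathbb{F}$ with $f(x,yz)=f(xy,z)+f(y,xz)$ for all $x,y,z$, and $\mathcal{B}^2(L,\mathbb{F})$ is the space of those of the form $f(x,y)=-\varepsilon(xy)$ with $\varepsilon:L\to\mathbb{F}$ linear. A pair $(K,M)$ of Leibniz algebras is a defining pair for $L$ if $L\cong K/M$ and $M\subseteq Z(K)\cap K'$; it is a maximal defining pair if $\dim K$ is maximal among defining pairs. In that case $K$ is called a cover of $L$ and $M$ is called the multiplier of $L$, denoted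 $M(L)$ (an abelian algebra, unique up to isomorphism).
   Formalization: The first isomorphism fails for some infinite-dimensional L; what is proved is that H^2(L,F) is isomorphic to the dual of (F'∩R)/(FR+RF) for every L, and to the quotient itself when that quotient (in particular when L) is finite-dimensional. *)

theory Defs
  imports Complex_Main "HOL-Library.Function_Algebras"
begin

text \<open>Vector spaces over the field type \<open>'f\<close>, and algebras over it, are given by an explicit
  carrier and explicit operations, so that subspaces, quotients and spaces of functions can be
  treated alike.\<close>

record ('f, 'v) vspace =
  vcarrier :: "'v set"
  vadd :: "'v \<Rightarrow> 'v \<Rightarrow> 'v"
  vscale :: "'f \<Rightarrow> 'v \<Rightarrow> 'v"

record ('f, 'v) alg = "('f, 'v) vspace" +
  mul :: "'v \<Rightarrow> 'v \<Rightarrow> 'v"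

definition sub_vspace :: "('f, 'v, 'm) vspace_scheme \<Rightarrow> 'v set \<Rightarrow> ('f, 'v) vspace" where
  "sub_vspace V S = \<lparr>vcarrier = S, vadd = vadd V, vscale = vscale V\<rparr>"

text \<open>The quotient by a subspace \<open>W\<close>, consisting of the cosets \<open>v + W\<close>. Adding \<open>W\<close> in the
  definition of scalar multiplication (and of multiplication below) matters, for example, for
  the scalar 0.\<close>

definition quot_vspace :: "('f, 'v, 'm) vspace_scheme \<Rightarrow> 'v set \<Rightarrow> ('f, 'v set) vspace" where
  "quot_vspace V W =
    \<lparr>vcarrier = {{vadd V v w | w. w \<in> W} | v. v \<in> vcarrier V},
     vadd = (\<lambda>A B. {vadd V a b | a b. a \<in> A \<and> b \<in> B}),
     vscale = (\<lambda>c A. {vadd V (vscale V c a) w | a w. a \<in> A \<and> w \<in> W})\<rparr>"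

definition quot_alg :: "('f, 'v) alg \<Rightarrow> 'v set \<Rightarrow> ('f, 'v set) alg" where
  "quot_alg A I =
    \<lparr>vcarrier = vcarrier (quot_vspace A I),
     vadd = vadd (quot_vspace A I),
     vscale = vscale (quot_vspace A I),
     mul = (\<lambda>B C. {vadd A (mul A b c) i | b c i. b \<in> B \<and> c \<in> C \<and> i \<in> I})\<rparr>"

definition lin_map ::
  "('f, 'v, 'm) vspace_scheme \<Rightarrow> ('f, 'w, 'n) vspace_scheme \<Rightarrow> ('v \<Rightarrow> 'w) \<Rightarrow> bool" where
  "lin_map V W \<phi> \<longleftrightarrow>
    (\<forall>x \<in> vcarrier V. \<phi> x \<in> vcarrier W) \<and>
    (\<forall>x \<in> vcarrier V. \<forall>y \<in> vcarrier V. \<phi> (vadd V x y) = vadd W (\<phi> x) (\<phi> y)) \<and>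
    (\<forall>c. \<forall>x \<in> vcarrier V. \<phi> (vscale V c x) = vscale W c (\<phi> x))"

definition alg_hom :: "('f, 'v) alg \<Rightarrow> ('f, 'w) alg \<Rightarrow> ('v \<Rightarrow> 'w) \<Rightarrow> bool" where
  "alg_hom A B \<phi> \<longleftrightarrow> lin_map A B \<phi> \<and>
    (\<forall>x \<in> vcarrier A. \<forall>y \<in> vcarrier A. \<phi> (mul A x y) = mul B (\<phi> x) (\<phi> y))"

definition vspace_iso :: "('f, 'v, 'm) vspace_scheme \<Rightarrow> ('f, 'w, 'n) vspace_scheme \<Rightarrow> bool" where
  "vspace_iso V W \<longleftrightarrow> (\<exists>\<phi>. lin_map V W \<phi> \<and> bij_betw \<phi> (vcarrier V) (vcarrier W))"

definition alg_iso :: "('f, 'v) alg \<Rightarrow> ('f, 'w) alg \<Rightarrow> bool" where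
  "alg_iso A B \<longleftrightarrow> (\<exists>\<phi>. alg_hom A B \<phi> \<and> bij_betw \<phi> (vcarrier A) (vcarrier B))"

text \<open>Spanned by a finite set \<open>B\<close>: the whole space is the only subspace containing \<open>B\<close>.\<close>

definition fin_dim :: "('f, 'v, 'm) vspace_scheme \<Rightarrow> bool" where
  "fin_dim V \<longleftrightarrow> (\<exists>B. finite B \<and> B \<subseteq> vcarrier V \<and>
    (\<forall>S. S \<noteq> {} \<and> B \<subseteq> S \<and> S \<subseteq> vcarrier V \<and>
         (\<forall>x \<in> S. \<forall>y \<in> S. vadd V x y \<in> S) \<and> (\<forall>c. \<forall>x \<in> S. vscale V c x \<in> S)
       \<longrightarrow> S = vcarrier V))"

definition ground_vspace :: "('f::field, 'f) vspace" where
  "ground_vspace = \<lparr>vcarrier = UNIV, vadd = (+), vscale = (*)\<rparr>"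

text \<open>A linear form, or a bilinear form below, on a carrier is represented by its extension by 0
  to the whole type.\<close>

definition linear_forms :: "('f::field, 'v, 'm) vspace_scheme \<Rightarrow> ('v \<Rightarrow> 'f) set" where
  "linear_forms V = {\<epsilon>. lin_map V ground_vspace \<epsilon> \<and> (\<forall>x. x \<notin> vcarrier V \<longrightarrow> \<epsilon> x = 0)}"

definition dual_vspace :: "('f::field, 'v, 'm) vspace_scheme \<Rightarrow> ('f, 'v \<Rightarrow> 'f) vspace" where
  "dual_vspace V = \<lparr>vcarrier = linear_forms V, vadd = (\<lambda>f g x. f x + g x),
                    vscale = (\<lambda>c f x. c * f x)\<rparr>"

text \<open>Left Leibniz algebras. The carrier is a subspace of an ambient vector space whose addition
  is that of the type; any Leibniz algebra is of this form, with itself as ambient space.\<close>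

definition leibniz_algebra :: "('f::field, 'a::ab_group_add) alg \<Rightarrow> bool" where
  "leibniz_algebra A \<longleftrightarrow>
    vector_space (vscale A) \<and> vadd A = (+) \<and> module.subspace (vscale A) (vcarrier A) \<and>
    (\<forall>x \<in> vcarrier A. \<forall>y \<in> vcarrier A. mul A x y \<in> vcarrier A) \<and>
    (\<forall>x \<in> vcarrier A. \<forall>y \<in> vcarrier A. \<forall>z \<in> vcarrier A.
       mul A (x + y) z = mul A x z + mul A y z \<and> mul A x (y + z) = mul A x y + mul A x z) \<and>
    (\<forall>c. \<forall>x \<in> vcarrier A. \<forall>y \<in> vcarrier A.
       mul A (vscale A c x) y = vscale A c (mul A x y) \<and>
       mul A x (vscale A c y) = vscale A c (mul A x y)) \<and>
    (\<forall>x \<in> vcarrier A. \<forall>y \<in> vcarrier A. \<forall>z \<in> vcarrier A.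
       mul A x (mul A y z) = mul A (mul A x y) z + mul A y (mul A x z))"

definition prod_span :: "('f::field, 'a::ab_group_add) alg \<Rightarrow> 'a set \<Rightarrow> 'a set \<Rightarrow> 'a set" where
  "prod_span A S T = module.span (vscale A) {mul A x y | x y. x \<in> S \<and> y \<in> T}"

definition derived :: "('f::field, 'a::ab_group_add) alg \<Rightarrow> 'a set" where
  "derived A = prod_span A (vcarrier A) (vcarrier A)"

definition center :: "('f::field, 'a::ab_group_add) alg \<Rightarrow> 'a set" where
  "center A = {z \<in> vcarrier A. \<forall>x \<in> vcarrier A. mul A z x = 0 \<and> mul A x z = 0}"

text \<open>The universal property of the free Leibniz algebra on \<open>X\<close>. HOL cannot quantify over all
  types here, so the test algebras \<open>B\<close> have their carriers in the type of functions
  from \<open>'a list\<close> to \<open>'f\<close>. This suffices: that type contains copies of all Leibniz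
  algebras whose dimension is at most the cardinality of \<open>'a list\<close>, hence of \<open>A\<close> itself and of a
  free Leibniz algebra on \<open>X\<close> (whose dimension is at most that of the set of words over \<open>X\<close>); so
  the property below already makes \<open>A\<close> isomorphic to the latter, compatibly with \<open>X\<close>.\<close>

definition free_leibniz_on :: "('f::field, 'a::ab_group_add) alg \<Rightarrow> 'a set \<Rightarrow> bool" where
  "free_leibniz_on A X \<longleftrightarrow> leibniz_algebra A \<and> X \<subseteq> vcarrier A \<and>
    (\<forall>(B :: ('f, 'a list \<Rightarrow> 'f) alg) g. leibniz_algebra B \<and> (\<forall>x \<in> X. g x \<in> vcarrier B) \<longrightarrow>
       (\<exists>\<phi>. alg_hom A B \<phi> \<and> (\<forall>x \<in> X. \<phi> x = g x)) \<and>
       (\<forall>\<phi> \<psi>. alg_hom A B \<phi> \<and> alg_hom A B \<psi> \<and> (\<forall>x \<in> X. \<phi> x = g x \<and> \<psi> x = g x)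
          \<longrightarrow> (\<forall>x \<in> vcarrier A. \<phi> x = \<psi> x)))"

text \<open>Exactness of \<open>0 \<rightarrow> R \<rightarrow> F \<rightarrow> L \<rightarrow> 0\<close>, with \<open>R\<close> a subset of \<open>F\<close> and \<open>\<pi>\<close> the map to \<open>L\<close>.\<close>

definition free_presentation ::
  "'b set \<Rightarrow> ('f::field, 'b::ab_group_add) alg \<Rightarrow> ('b \<Rightarrow> 'a) \<Rightarrow> ('f, 'a::ab_group_add) alg \<Rightarrow> bool"
  where
  "free_presentation R F \<pi> L \<longleftrightarrow>
    (\<exists>X. free_leibniz_on F X) \<and> leibniz_algebra L \<and> alg_hom F L \<pi> \<and>
    \<pi> ` vcarrier F = vcarrier L \<and> R = {x \<in> vcarrier F. \<pi> x = 0}"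

text \<open>The space \<open>(F' \<inter> R) / (FR + RF)\<close>. In general the second cohomology space is isomorphic to
  its dual, and to the space itself only if the latter is finite-dimensional: for \<open>L\<close> abelian with
  a countably infinite basis, \<open>(F' \<inter> R) / (FR + RF)\<close> is the tensor square of \<open>L\<close>, of countable
  dimension, whereas the cohomology space consists of all bilinear forms on \<open>L\<close>.\<close>

definition hopf_quotient ::
  "('f::field, 'b::ab_group_add) alg \<Rightarrow> 'b set \<Rightarrow> ('f, 'b set) vspace" where
  "hopf_quotient F R =
    quot_vspace (sub_vspace F (derived F \<inter> R))
      {a + b | a b. a \<in> prod_span F (vcarrier F) R \<and> b \<in> prod_span F R (vcarrier F)}"

definition cocycles2 :: "('f::field, 'a::ab_group_add) alg \<Rightarrow> ('a \<Rightarrow> 'a \<Rightarrow> 'f) set" where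
  "cocycles2 L = {f.
    (\<forall>x \<in> vcarrier L. \<forall>y \<in> vcarrier L. \<forall>z \<in> vcarrier L.
       f (x + y) z = f x z + f y z \<and> f x (y + z) = f x y + f x z) \<and>
    (\<forall>c. \<forall>x \<in> vcarrier L. \<forall>y \<in> vcarrier L.
       f (vscale L c x) y = c * f x y \<and> f x (vscale L c y) = c * f x y) \<and>
    (\<forall>x \<in> vcarrier L. \<forall>y \<in> vcarrier L. \<forall>z \<in> vcarrier L.
       f x (mul L y z) = f (mul L x y) z + f y (mul L x z)) \<and>
    (\<forall>x y. x \<notin> vcarrier L \<or> y \<notin> vcarrier L \<longrightarrow> f x y = 0)}"

definition coboundaries2 :: "('f::field, 'a::ab_group_add) alg \<Rightarrow> ('a \<Rightarrow> 'a \<Rightarrow> 'f) set" where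
  "coboundaries2 L = {f \<in> cocycles2 L.
    \<exists>\<epsilon> \<in> linear_forms L. \<forall>x \<in> vcarrier L. \<forall>y \<in> vcarrier L. f x y = - \<epsilon> (mul L x y)}"

definition cohomology2 ::
  "('f::field, 'a::ab_group_add) alg \<Rightarrow> ('f, ('a \<Rightarrow> 'a \<Rightarrow> 'f) set) vspace" where
  "cohomology2 L =
    quot_vspace \<lparr>vcarrier = cocycles2 L, vadd = (\<lambda>f g x y. f x y + g x y),
                 vscale = (\<lambda>c f x y. c * f x y)\<rparr>
      (coboundaries2 L)"

definition defining_pair ::
  "('f::field, 'a::ab_group_add) alg \<Rightarrow> ('f, 'k::ab_group_add) alg \<Rightarrow> 'k set \<Rightarrow> bool" where
  "defining_pair L K M \<longleftrightarrow>
    leibniz_algebra K \<and> module.subspace (vscale K) M \<and> M \<subseteq> center K \<inter> derived K \<and>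
    alg_iso L (quot_alg K M)"

text \<open>The competing pairs have their carriers in \<open>nat \<Rightarrow> 'f\<close>. If \<open>L\<close> is finite-dimensional, then
  so is \<open>K\<close> for every defining pair \<open>(K, M)\<close>: \<open>K / center K\<close> is finite-dimensional, hence so is
  \<open>derived K\<close>, which contains \<open>M\<close>. So every defining pair has an isomorphic copy there. (If \<open>L\<close>
  is infinite-dimensional, all \<open>K\<close> have the dimension of \<open>L\<close>, and all defining pairs
  are maximal; this agrees with the convention \<open>dim K = 0\<close> for infinite-dimensional \<open>K\<close>.)\<close>

definition maximal_defining_pair ::
  "('f::field, 'a::ab_group_add) alg \<Rightarrow> ('f, 'k::ab_group_add) alg \<Rightarrow> 'k set \<Rightarrow> bool" where
  "maximal_defining_pair L K M \<longleftrightarrow> defining_pair L K M \<and>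
    (\<forall>(K1 :: ('f, nat \<Rightarrow> 'f) alg) M1. defining_pair L K1 M1 \<longrightarrow>
       vector_space.dim (vscale K1) (vcarrier K1) \<le> vector_space.dim (vscale K) (vcarrier K))"

end

theory Submission
  imports Defs
begin

text \<open>Let \<open>p : A \<rightarrow> L\<close> be a surjective homomorphism with kernel \<open>N\<close>. A linear form \<open>\<epsilon>\<close> on \<open>A\<close> that
  vanishes on \<open>W = AN + NA\<close> induces a cocycle on \<open>L\<close> by \<open>(p x, p y) \<mapsto> - \<epsilon> (x y)\<close>, and this cocycle is
  a coboundary exactly if \<open>\<epsilon>\<close> vanishes on \<open>A' \<inter> N\<close>. Hence the dual of \<open>(A' \<inter> N) / W\<close> embeds in the
  second cohomology space of \<open>L\<close>.

  If \<open>A\<close> is free, the embedding is onto: the pullback to \<open>A\<close> of a cocycle on \<open>L\<close> defines a central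
  extension of \<open>A\<close>, and its splitting, given by freeness, is a linear form that induces the cocycle.

  If \<open>(A, N)\<close> is a defining pair of a finite-dimensional \<open>L\<close>, then \<open>W = 0\<close> and \<open>A' \<inter> N = N\<close>, so
  \<open>dim N\<close> is at most the dimension of the cohomology space. The bound is attained by the central
  extension of \<open>L\<close> by a family of cocycles that is a basis modulo coboundaries: a linear form that
  vanishes on the products would exhibit a linear combination of the family as a coboundary.\<close>

section \<open>Linear algebra on explicit carriers\<close>

text \<open>Cosets are sets without a group structure of their own, so no argument runs on the
  quotients themselves. Complements \<open>C\<close> of \<open>W\<close> in
  \<open>A' \<inter> N\<close> and \<open>D\<close> of the coboundaries in the cocycles stand in for
  them; the embedding becomes a map from forms on \<open>C\<close> to \<open>D\<close>, and the
  quotients return only through \<open>vspace_iso\<close>. A cocycle corresponds to a form on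
  \<open>A' \<inter> N\<close>, so what appears naturally is a dual; removing it needs finite
  dimension. For finite-dimensional \<open>L\<close> this is available even though a free
  \<open>A\<close> may be infinite-dimensional: modulo \<open>W\<close> a product depends only on
  its factors modulo \<open>N\<close>, so finitely many products and \<open>W\<close> span
  \<open>A'\<close>. Freeness is tested only on algebras of functions from words to the field, and a
  cover has to be found among functions on \<open>nat\<close>. Central extensions are therefore
  built from coordinate functions over an arbitrary index type, and one construction serves both
  purposes.\<close>

lemma vector_space_field: "vector_space ((*) :: 'f::field \<Rightarrow> 'f \<Rightarrow> 'f)"
  by unfold_locales (auto simp: algebra_simps)

lemma vector_space_pair_field:
  assumes "vector_space s"
  shows "vector_space_pair s ((*) :: 'f::field \<Rightarrow> 'f \<Rightarrow> 'f)"
  using assms vector_space_field by (simp add: vector_space_pair_def)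

lemma vector_space_fun: "vector_space (\<lambda>(c::'f::field) f x. c * f x)"
  by unfold_locales (auto simp: algebra_simps fun_eq_iff)

lemma vector_space_fun2: "vector_space (\<lambda>(c::'f::field) f x y. c * f x y)"
  by unfold_locales (auto simp: algebra_simps fun_eq_iff)

section \<open>Extending and factoring linear maps\<close>

context vector_space_pair
begin

text \<open>Homomorphisms and forms are linear on a carrier only, while
  \<open>Vector_Spaces.linear\<close> concerns the whole type. Prescribing the values of
  \<open>f\<close> on a basis of \<open>S\<close> gives a total map, and agreement spreads from the
  basis to its span.\<close>

lemma linear_on_extend:
  assumes S: "vs1.subspace S"
    and add: "\<And>x y. x \<in> S \<Longrightarrow> y \<in> S \<Longrightarrow> f (x + y) = f x + f y"
    and scale: "\<And>c x. x \<in> S \<Longrightarrow> f (s1 c x) = s2 c (f x)"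
  obtains g where "Vector_Spaces.linear s1 s2 g" "\<And>x. x \<in> S \<Longrightarrow> g x = f x"
proof -
  obtain B where B: "B \<subseteq> S" "vs1.independent B" "S \<subseteq> vs1.span B"
    using vs1.maximal_independent_subset by blast
  obtain g where g: "Vector_Spaces.linear s1 s2 g" "\<forall>x\<in>B. g x = f x"
    using linear_independent_extend[OF B(2)] by blast
  interpret g: Vector_Spaces.linear s1 s2 g by (rule g(1))
  have f0: "f 0 = 0"
    using scale[of 0 0] vs1.subspace_0[OF S] by simp
  have "x \<in> S \<and> g x = f x" if "x \<in> vs1.span B" for x
    using that
  proof (induction rule: vs1.span_induct_alt)
    case base
    then show ?case using vs1.subspace_0[OF S] f0 by (simp add: g.zero)
  next
    case (step c x y)
    have "x \<in> S" using step B by blast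
    then show ?case
      using step g(2) add scale vs1.subspace_add[OF S] vs1.subspace_scale[OF S]
      by (simp add: g.add g.scale)
  qed
  then show ?thesis using that g(1) B(3) by blast
qed

text \<open>Two preimages in \<open>U\<close> of the same point differ by an element of
  \<open>U\<close> in the kernel of \<open>p\<close>, where \<open>g\<close> vanishes. An arbitrary
  choice of preimages thus gives a linear map on the image of \<open>U\<close>, which then
  extends.\<close>

lemma linear_factor:
  assumes p: "Vector_Spaces.linear s3 s1 p" and g: "Vector_Spaces.linear s3 s2 g"
    and U: "module.subspace s3 U"
    and ker: "\<And>u. u \<in> U \<Longrightarrow> p u = 0 \<Longrightarrow> g u = 0"
  obtains h where "Vector_Spaces.linear s1 s2 h" "\<And>u. u \<in> U \<Longrightarrow> h (p u) = g u"
proof -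
  interpret p: Vector_Spaces.linear s3 s1 p by (rule p)
  interpret g: Vector_Spaces.linear s3 s2 g by (rule g)
  define f where "f y = g (inv_into U p y)" for y
  have f: "f (p u) = g u" if "u \<in> U" for u
  proof -
    let ?v = "inv_into U p (p u)"
    have v: "?v \<in> U" "p ?v = p u" using that by (auto simp: inv_into_into f_inv_into_f)
    have "g (?v - u) = 0"
      by (rule ker) (use v that in \<open>auto simp: p.diff intro: p.vs1.subspace_diff[OF U]\<close>)
    then show ?thesis by (simp add: f_def g.diff)
  qed
  obtain h where h: "Vector_Spaces.linear s1 s2 h" "\<And>y. y \<in> p ` U \<Longrightarrow> h y = f y"
  proof (rule linear_on_extend)
    show "vs1.subspace (p ` U)" by (rule p.subspace_image[OF U])
    show "f (x + y) = f x + f y" if xy: "x \<in> p ` U" "y \<in> p ` U" for x y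
    proof -
      obtain u v where uv: "u \<in> U" "v \<in> U" "x = p u" "y = p v" using xy by blast
      then show ?thesis
        using f[of "u + v"] f[of u] f[of v] p.vs1.subspace_add[OF U uv(1,2)]
        by (simp add: p.add g.add)
    qed
    show "f (s1 c x) = s2 c (f x)" if x: "x \<in> p ` U" for c x
    proof -
      obtain u where u: "u \<in> U" "x = p u" using x by blast
      then show ?thesis
        using f[of "s3 c u"] f[of u] p.vs1.subspace_scale[OF U u(1)]
        by (simp add: p.scale g.scale)
    qed
  qed blast
  show ?thesis
    by (rule that[OF h(1)]) (use h(2) f in simp)
qed

end

section \<open>Separating forms and complements\<close>

context vector_space
begin

text \<open>Adding \<open>w\<close> to a basis of \<open>S\<close> keeps it independent, so a linear
  map may take the value 1 at \<open>w\<close> and 0 on that basis.\<close>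

lemma subspace_separation:
  assumes S: "subspace S" and w: "w \<notin> S"
  obtains \<psi> where "Vector_Spaces.linear scale (*) \<psi>" "\<And>x. x \<in> S \<Longrightarrow> \<psi> x = 0" "\<psi> w \<noteq> 0"
proof -
  interpret f: vector_space_pair scale "(*)"
    by (rule vector_space_pair_field) (rule vector_space_axioms)
  obtain B where B: "B \<subseteq> S" "independent B" "S \<subseteq> span B"
    using maximal_independent_subset by blast
  have sB: "span B = S" using span_subspace[OF B(1,3) S] .
  have "independent (insert w B)" using w B by (simp add: sB independent_insertI)
  then obtain g where g: "Vector_Spaces.linear scale (*) g"
      "\<forall>x\<in>insert w B. g x = (if x = w then 1 else 0)"
    using f.linear_independent_extend[of "insert w B" "\<lambda>x. if x = w then 1 else 0"] by blast
  interpret g: Vector_Spaces.linear scale "(*)" g by (rule g(1))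
  have gB: "g b = 0" if "b \<in> B" for b using that g(2) B(1) w by auto
  have "g x = 0" if "x \<in> S" for x
    using g.eq_0_on_span[OF gB] that by (simp add: sB)
  then show ?thesis using that g by auto
qed

lemma subspace_complement:
  assumes V: "subspace V" and W: "subspace W" "W \<subseteq> V"
  obtains q where "Vector_Spaces.linear scale scale q" "range q \<subseteq> q ` V" "subspace (q ` V)" "q ` V \<subseteq> V"
    "\<And>w. w \<in> W \<Longrightarrow> q w = 0" "\<And>v. v \<in> V \<Longrightarrow> v - q v \<in> W" "\<And>v. v \<in> q ` V \<Longrightarrow> q v = v"
proof -
  interpret f: vector_space_pair scale scale by unfold_locales
  obtain B where B: "B \<subseteq> W" "independent B" "W \<subseteq> span B"
    using maximal_independent_subset by blast
  have sB: "span B = W" using span_subspace[OF B(1,3) W(1)] .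
  obtain E where E: "B \<subseteq> E" "E \<subseteq> V" "independent E" "V \<subseteq> span E"
    using maximal_independent_subset_extend[OF order_trans[OF B(1) W(2)] B(2)] by blast
  have sE: "span E = V" using span_subspace[OF E(2,4) V] .
  \<comment> \<open>Basis vectors in \<open>W\<close> are dropped and the others kept: on
    \<open>V\<close> this is a projection along \<open>W\<close>.\<close>
  obtain q where q: "Vector_Spaces.linear scale scale q" "\<forall>x\<in>E. q x = (if x \<in> B then 0 else x)"
    using f.linear_independent_extend[OF E(3), of "\<lambda>x. if x \<in> B then 0 else x"] by blast
  interpret q: Vector_Spaces.linear scale scale q by (rule q(1))
  have qB: "q b = 0" if "b \<in> B" for b using that q(2) E(1) by auto
  have qW: "q w = 0" if "w \<in> W" for w
    using q.eq_0_on_span[OF qB] that by (simp add: sB)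
  have main: "v - q v \<in> W \<and> q v \<in> V" if "v \<in> V" for v
    using that unfolding sE[symmetric]
  proof (induction rule: span_induct_alt)
    case base
    then show ?case by (simp add: q.zero subspace_0[OF W(1)] span_zero)
  next
    case (step c x y)
    have "q x \<in> span E" "x - q x \<in> W"
      using step q(2) B(1) by (auto simp: span_base span_zero subspace_0[OF W(1)])
    moreover have eq: "scale c x + y - q (scale c x + y) = scale c (x - q x) + (y - q y)"
      by (simp add: q.add q.scale scale_right_diff_distrib)
    ultimately have "scale c x + y - q (scale c x + y) \<in> W"
      using step(2) by (simp only: eq) (intro subspace_add[OF W(1)] subspace_scale[OF W(1)]; blast)
    moreover have "q (scale c x + y) \<in> span E"
      using step(2) \<open>q x \<in> span E\<close> by (simp add: q.add q.scale span_add span_scale)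
    ultimately show ?case by simp
  qed
  have qV: "q ` V \<subseteq> V" "\<And>v. v \<in> V \<Longrightarrow> v - q v \<in> W" using main by auto
  have qq: "q v = v" if v: "v \<in> q ` V" for v
  proof -
    obtain u where u: "u \<in> V" "v = q u" using v by blast
    have "q u - q (q u) = 0" using qW[OF qV(2)[OF u(1)]] by (simp only: q.diff)
    then show ?thesis by (simp add: u(2))
  qed
  \<comment> \<open>Outside \<open>V\<close> the map \<open>q\<close> is uncontrolled.
    Precomposition with a linear retraction \<open>g\<close> of the whole type onto \<open>V\<close>
    confines the range.\<close>
  obtain g where g: "range g \<subseteq> V" "Vector_Spaces.linear scale scale g" "\<forall>v\<in>V. id (g (id v)) = v"
    using f.linear_exists_left_inverse_on[OF linear_id V inj_on_id] by auto
  have gV: "g v = v" if "v \<in> V" for v using g(3) that by simp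
  have im: "(q \<circ> g) ` V = q ` V" by (rule image_cong) (simp_all add: gV)
  show ?thesis
  proof (rule that[OF Vector_Spaces.linear_compose[OF g(2) q(1)]], unfold im)
    show "range (q \<circ> g) \<subseteq> q ` V" using g(1) by auto
    show "subspace (q ` V)" by (rule q.subspace_image[OF V])
    show "(q \<circ> g) w = 0" if "w \<in> W" for w using that W(2) gV[of w] qW[of w] by (simp add: subset_iff)
    show "(q \<circ> g) v = v" if "v \<in> q ` V" for v using qV(1) qq[OF that] gV[of v] that by (simp add: subset_iff)
  qed (use qV gV in simp_all)
qed

end

text \<open>The shape to which spans, bases and dimension of the ambient vector space apply.
  Quotients do not have it, as cosets are sets; they are reached through a complement and
  \<open>vspace_iso\<close>.\<close>

definition concrete_vspace :: "('f::field, 'v::ab_group_add, 'm) vspace_scheme \<Rightarrow> bool" where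
  "concrete_vspace V \<longleftrightarrow>
    vector_space (vscale V) \<and> vadd V = (+) \<and> module.subspace (vscale V) (vcarrier V)"

lemma sub_vspace_simps [simp]:
  "vcarrier (sub_vspace V S) = S" "vadd (sub_vspace V S) = vadd V"
  "vscale (sub_vspace V S) = vscale V" "sub_vspace (sub_vspace V S) T = sub_vspace V T"
  by (simp_all add: sub_vspace_def)

lemma concrete_vspace_sub:
  "concrete_vspace V \<Longrightarrow> module.subspace (vscale V) S \<Longrightarrow> concrete_vspace (sub_vspace V S)"
  by (simp add: concrete_vspace_def)

text \<open>What inverting a linear bijection requires of its source. It makes sense for spaces of
  any shape, duals included.\<close>

definition vspace_closed :: "('f, 'v, 'm) vspace_scheme \<Rightarrow> bool" where
  "vspace_closed V \<longleftrightarrow> (\<forall>x \<in> vcarrier V. \<forall>y \<in> vcarrier V. vadd V x y \<in> vcarrier V) \<and>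
     (\<forall>c. \<forall>x \<in> vcarrier V. vscale V c x \<in> vcarrier V)"

lemma concrete_vspace_closed:
  assumes "concrete_vspace V"
  shows "vspace_closed V"
proof -
  interpret vector_space "vscale V" using assms by (simp add: concrete_vspace_def)
  show ?thesis using assms
    by (auto simp: concrete_vspace_def vspace_closed_def subspace_add subspace_scale)
qed

lemma lin_map_inv_into:
  assumes \<phi>: "lin_map V W \<phi>" "bij_betw \<phi> (vcarrier V) (vcarrier W)" and V: "vspace_closed V"
  shows "lin_map W V (inv_into (vcarrier V) \<phi>)"
proof -
  let ?\<psi> = "inv_into (vcarrier V) \<phi>"
  have inj: "inj_on \<phi> (vcarrier V)" and im: "\<phi> ` vcarrier V = vcarrier W"
    using \<phi>(2) by (auto simp: bij_betw_def)
  have add: "?\<psi> (vadd W (\<phi> x) (\<phi> y)) = vadd V x y" if "x \<in> vcarrier V" "y \<in> vcarrier V" for x y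
  proof -
    have "vadd W (\<phi> x) (\<phi> y) = \<phi> (vadd V x y)" "vadd V x y \<in> vcarrier V"
      using that \<phi>(1) V by (auto simp: lin_map_def vspace_closed_def)
    then show ?thesis by (simp add: inv_into_f_f[OF inj])
  qed
  have sc: "?\<psi> (vscale W c (\<phi> x)) = vscale V c x" if "x \<in> vcarrier V" for x c
  proof -
    have "vscale W c (\<phi> x) = \<phi> (vscale V c x)" "vscale V c x \<in> vcarrier V"
      using that \<phi>(1) V by (auto simp: lin_map_def vspace_closed_def)
    then show ?thesis by (simp add: inv_into_f_f[OF inj])
  qed
  show ?thesis
    unfolding lin_map_def im[symmetric] by (auto simp: add sc inv_into_f_f[OF inj])
qed

lemma vspace_iso_sym: "vspace_iso V W \<Longrightarrow> vspace_closed V \<Longrightarrow> vspace_iso W V"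
  unfolding vspace_iso_def using lin_map_inv_into bij_betw_inv_into by blast

lemma lin_map_compose: "lin_map U V \<phi> \<Longrightarrow> lin_map V W \<psi> \<Longrightarrow> lin_map U W (\<psi> \<circ> \<phi>)"
  by (simp add: lin_map_def)

lemma vspace_iso_trans: "vspace_iso U V \<Longrightarrow> vspace_iso V W \<Longrightarrow> vspace_iso U W"
  unfolding vspace_iso_def using lin_map_compose bij_betw_trans by blast

lemma fin_dim_iso:
  assumes iso: "vspace_iso V W" and V: "vspace_closed V" and fin: "fin_dim W"
  shows "fin_dim V"
proof -
  obtain \<phi> where \<phi>: "lin_map V W \<phi>" "bij_betw \<phi> (vcarrier V) (vcarrier W)"
    using iso by (auto simp: vspace_iso_def)
  have inj: "inj_on \<phi> (vcarrier V)" and im: "\<phi> ` vcarrier V = vcarrier W"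
    using \<phi>(2) by (auto simp: bij_betw_def)
  obtain B where B: "finite B" "B \<subseteq> vcarrier W"
    "\<And>S. S \<noteq> {} \<Longrightarrow> B \<subseteq> S \<Longrightarrow> S \<subseteq> vcarrier W \<Longrightarrow> \<forall>x \<in> S. \<forall>y \<in> S. vadd W x y \<in> S \<Longrightarrow>
       \<forall>c. \<forall>x \<in> S. vscale W c x \<in> S \<Longrightarrow> S = vcarrier W"
    using fin unfolding fin_dim_def by metis
  let ?\<psi> = "inv_into (vcarrier V) \<phi>"
  show ?thesis unfolding fin_dim_def
  proof (intro exI[of _ "?\<psi> ` B"] conjI allI impI)
    show "finite (?\<psi> ` B)" using B(1) by simp
    show "?\<psi> ` B \<subseteq> vcarrier V" using B(2) by (auto simp: im[symmetric] inv_into_into)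
    fix S assume S: "S \<noteq> {} \<and> ?\<psi> ` B \<subseteq> S \<and> S \<subseteq> vcarrier V \<and>
      (\<forall>x\<in>S. \<forall>y\<in>S. vadd V x y \<in> S) \<and> (\<forall>c. \<forall>x\<in>S. vscale V c x \<in> S)"
    have lin: "\<And>x y. x \<in> S \<Longrightarrow> y \<in> S \<Longrightarrow> vadd W (\<phi> x) (\<phi> y) = \<phi> (vadd V x y)"
      "\<And>c x. x \<in> S \<Longrightarrow> vscale W c (\<phi> x) = \<phi> (vscale V c x)"
      using \<phi>(1) S by (auto simp: lin_map_def subset_iff)
    have "\<phi> ` S \<subseteq> vcarrier W" using S im by blast
    have "\<phi> ` S = vcarrier W"
    proof (rule B(3))
      show "B \<subseteq> \<phi> ` S"
      proof
        fix b assume b: "b \<in> B"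
        then have "\<phi> (?\<psi> b) = b" using B(2) im by (intro f_inv_into_f) auto
        then show "b \<in> \<phi> ` S" using S b by (metis image_eqI image_subset_iff)
      qed
    qed (use S lin \<open>\<phi> ` S \<subseteq> vcarrier W\<close> in auto)
    then show "S = vcarrier V" using S inj im
      by (metis inj_on_image_eq_iff order_refl)
  qed
qed

text \<open>Forms are transported by composition with the inverse isomorphism. Since forms are
  stored as 0 off the carrier, the transport \<open>T\<close> is cut off there too.\<close>

lemma dual_vspace_iso:
  fixes V :: "('f::field, 'v, 'm) vspace_scheme" and W :: "('f, 'w, 'n) vspace_scheme"
  assumes iso: "vspace_iso V W" and V: "vspace_closed V"
  shows "vspace_iso (dual_vspace V) (dual_vspace W)"
proof -
  obtain \<phi> where \<phi>: "lin_map V W \<phi>" "bij_betw \<phi> (vcarrier V) (vcarrier W)"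
    using iso by (auto simp: vspace_iso_def)
  have inj: "inj_on \<phi> (vcarrier V)" and im: "\<phi> ` vcarrier V = vcarrier W"
    using \<phi>(2) by (auto simp: bij_betw_def)
  let ?\<psi> = "inv_into (vcarrier V) \<phi>"
  note \<psi> = lin_map_inv_into[OF \<phi> V]
  have \<psi>\<phi>: "?\<psi> (\<phi> x) = x" "\<phi> x \<in> vcarrier W" if "x \<in> vcarrier V" for x
    using that inj im by auto
  have \<phi>\<psi>: "\<phi> (?\<psi> y) = y" "?\<psi> y \<in> vcarrier V" if "y \<in> vcarrier W" for y
    using that im by (auto simp: f_inv_into_f inv_into_into)
  define T where "T h = (\<lambda>w. if w \<in> vcarrier W then h (?\<psi> w) else 0)" for h :: "'v \<Rightarrow> 'f"
  have "vadd W (\<phi> x) (\<phi> y) = \<phi> (vadd V x y)" "vscale W c (\<phi> x) = \<phi> (vscale V c x)"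
    if "x \<in> vcarrier V" "y \<in> vcarrier V" for x y c
    using that \<phi>(1) by (auto simp: lin_map_def)
  then have W: "vspace_closed W"
    using V unfolding vspace_closed_def im[symmetric] by auto
  have T: "T h \<in> linear_forms W" if "h \<in> linear_forms V" for h
    using that \<psi> W by (auto simp: linear_forms_def T_def lin_map_def ground_vspace_def vspace_closed_def)
  have "bij_betw T (linear_forms V) (linear_forms W)"
  proof (rule bij_betw_byWitness[where f' = "\<lambda>g v. if v \<in> vcarrier V then g (\<phi> v) else 0"])
    show "\<forall>a\<in>linear_forms V. (\<lambda>v. if v \<in> vcarrier V then T a (\<phi> v) else 0) = a"
      by (auto simp: T_def \<psi>\<phi> linear_forms_def)
    show "\<forall>a'\<in>linear_forms W. T (\<lambda>v. if v \<in> vcarrier V then a' (\<phi> v) else 0) = a'"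
      by (auto simp: T_def \<phi>\<psi> linear_forms_def)
    show "T ` linear_forms V \<subseteq> linear_forms W" using T by blast
    show "(\<lambda>g v. if v \<in> vcarrier V then g (\<phi> v) else 0) ` linear_forms W \<subseteq> linear_forms V"
      using \<phi>(1) V by (auto simp: linear_forms_def lin_map_def ground_vspace_def vspace_closed_def)
  qed
  moreover have "lin_map (dual_vspace V) (dual_vspace W) T"
    using T by (auto simp: lin_map_def dual_vspace_def T_def)
  ultimately show ?thesis
    by (auto simp: vspace_iso_def dual_vspace_def)
qed

text \<open>The span of the finite set \<open>G\<close> is among the subspaces tested by
  \<open>fin_dim\<close>, hence is the whole carrier; a maximal independent subset is then
  finite.\<close>

lemma fin_dim_basis:
  assumes V: "concrete_vspace V" and fin: "fin_dim V"
  obtains B where "finite B" "\<not> module.dependent (vscale V) B" "module.span (vscale V) B = vcarrier V"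
proof -
  interpret vector_space "vscale V" using V by (simp add: concrete_vspace_def)
  have sub: "subspace (vcarrier V)" and add: "vadd V = (+)" using V by (auto simp: concrete_vspace_def)
  obtain G where G: "finite G" "G \<subseteq> vcarrier V"
    "\<And>S. S \<noteq> {} \<Longrightarrow> G \<subseteq> S \<Longrightarrow> S \<subseteq> vcarrier V \<Longrightarrow> \<forall>x \<in> S. \<forall>y \<in> S. x + y \<in> S \<Longrightarrow>
       \<forall>c. \<forall>x \<in> S. vscale V c x \<in> S \<Longrightarrow> S = vcarrier V"
    using fin unfolding fin_dim_def add by metis
  have sG: "span G = vcarrier V"
    by (rule G(3)) (use G(2) sub span_zero in \<open>auto simp: span_base span_add span_scale dest: span_minimal[OF G(2) sub, THEN subsetD]\<close>)
  obtain B where B: "B \<subseteq> vcarrier V" "independent B" "vcarrier V \<subseteq> span B"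
    using maximal_independent_subset by blast
  have "finite B" using independent_span_bound[OF G(1) B(2)] B(1) sG by auto
  then show ?thesis using that B span_subspace[OF B(1,3) sub] by blast
qed

lemma dual_fin_dim_iso:
  assumes V: "concrete_vspace V" and B: "finite B" "\<not> module.dependent (vscale V) B"
    "module.span (vscale V) B = vcarrier V"
  shows "vspace_iso V (dual_vspace V)"
proof -
  interpret vector_space "vscale V" using V by (simp add: concrete_vspace_def)
  have add: "vadd V = (+)" using V by (auto simp: concrete_vspace_def)
  note closed = concrete_vspace_closed[OF V, unfolded vspace_closed_def add]
  let ?r = "representation B"
  note rep = representation_add[OF B(2)] representation_scale[OF B(2)] representation_basis[OF B(2)]
  \<comment> \<open>\<open>\<phi> x\<close> is the pairing with \<open>x\<close> under the bilinear
    form for which \<open>B\<close> is orthonormal.\<close>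
  define \<phi> where "\<phi> x = (\<lambda>y. if y \<in> vcarrier V then \<Sum>b\<in>B. ?r x b * ?r y b else 0)" for x
  have \<phi>: "\<phi> x \<in> linear_forms V" if "x \<in> vcarrier V" for x
    using that closed by (auto simp: linear_forms_def lin_map_def ground_vspace_def \<phi>_def add B(3) rep
        algebra_simps sum.distrib sum_distrib_left)
  have Bc: "B \<subseteq> vcarrier V" using span_superset[of B] B(3) by simp
  have ev: "\<phi> x b = ?r x b" if "x \<in> vcarrier V" "b \<in> B" for x b
  proof -
    have "\<phi> x b = (\<Sum>b'\<in>B. if b' = b then ?r x b' else 0)"
      using that Bc by (auto simp: \<phi>_def rep intro!: sum.cong)
    then show ?thesis using that B(1) by simp
  qed
  have exp: "x = (\<Sum>b\<in>B. vscale V (?r x b) b)" if "x \<in> vcarrier V" for x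
    using sum_representation_eq[OF B(2) _ B(1) order_refl, of x] that B(3) by simp
  have "bij_betw \<phi> (vcarrier V) (linear_forms V)"
    unfolding bij_betw_def
  proof (intro conjI equalityI subsetI)
    show "inj_on \<phi> (vcarrier V)"
    proof (rule inj_onI)
      fix x y assume xy: "x \<in> vcarrier V" "y \<in> vcarrier V" "\<phi> x = \<phi> y"
      then have "?r x b = ?r y b" if "b \<in> B" for b using ev that by metis
      then show "x = y" using exp[OF xy(1)] exp[OF xy(2)] by simp
    qed
  next
    fix h assume "h \<in> linear_forms V"
    then have h: "\<And>x y. x \<in> vcarrier V \<Longrightarrow> y \<in> vcarrier V \<Longrightarrow> h (x + y) = h x + h y"
      "\<And>c x. x \<in> vcarrier V \<Longrightarrow> h (vscale V c x) = c * h x"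
      "\<And>x. x \<notin> vcarrier V \<Longrightarrow> h x = 0"
      by (auto simp: linear_forms_def lin_map_def ground_vspace_def add)
    interpret f: vector_space_pair "vscale V" "(*)"
      by (rule vector_space_pair_field) (rule vector_space_axioms)
    obtain g where g: "Vector_Spaces.linear (vscale V) (*) g" "\<And>x. x \<in> vcarrier V \<Longrightarrow> g x = h x"
      using f.linear_on_extend[of "vcarrier V" h] h V by (auto simp: concrete_vspace_def)
    interpret g: Vector_Spaces.linear "vscale V" "(*)" g by (rule g(1))
    \<comment> \<open>The vector representing \<open>h\<close>: its coordinates are the values of
      \<open>h\<close> on \<open>B\<close>.\<close>
    define x where "x = (\<Sum>b\<in>B. vscale V (h b) b)"
    have x: "x \<in> vcarrier V"
      unfolding x_def B(3)[symmetric] by (intro span_sum span_scale span_base)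
    have "?r x b = h b" if "b \<in> B" for b
    proof -
      have "?r x b = (\<Sum>b'\<in>B. h b' * ?r b' b)"
        unfolding x_def using representation_sum[OF B(2), of B "\<lambda>b. vscale V (h b) b"]
        by (simp add: span_base span_scale representation_scale[OF B(2)])
      also have "\<dots> = (\<Sum>b'\<in>B. if b' = b then h b' else 0)"
        by (rule sum.cong) (auto simp: rep)
      finally show ?thesis using that B(1) by simp
    qed
    moreover have "h y = (\<Sum>b\<in>B. ?r y b * h b)" if "y \<in> vcarrier V" for y
    proof -
      have "h y = g (\<Sum>b\<in>B. vscale V (?r y b) b)" using g(2)[OF that] exp[OF that] by simp
      also have "\<dots> = (\<Sum>b\<in>B. ?r y b * g b)" by (simp add: g.sum g.scale)
      finally show ?thesis using g(2) Bc by (simp add: subset_iff)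
    qed
    ultimately have "\<phi> x = h" using h(3) by (auto simp: \<phi>_def fun_eq_iff mult.commute)
    then show "h \<in> \<phi> ` vcarrier V" using x by blast
  qed (use \<phi> in blast)
  moreover have "lin_map V (dual_vspace V) \<phi>"
    using \<phi> by (auto simp: lin_map_def dual_vspace_def \<phi>_def add B(3) rep fun_eq_iff algebra_simps
        sum.distrib sum_distrib_left)
  ultimately show ?thesis by (auto simp: vspace_iso_def dual_vspace_def)
qed

section \<open>Cosets and quotient spaces\<close>

definition vcoset :: "('f, 'v, 'm) vspace_scheme \<Rightarrow> 'v set \<Rightarrow> 'v \<Rightarrow> 'v set" where
  "vcoset V W v = {vadd V v w | w. w \<in> W}"

lemma vcarrier_quot_vspace: "vcarrier (quot_vspace V W) = vcoset V W ` vcarrier V"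
  by (auto simp: quot_vspace_def vcoset_def)

context
  fixes V :: "('f::field, 'v::ab_group_add, 'm) vspace_scheme" and W :: "'v set"
  assumes V: "concrete_vspace V" and W: "module.subspace (vscale V) W"
begin

interpretation vector_space "vscale V" using V by (simp add: concrete_vspace_def)

lemma vcoset_iff: "x \<in> vcoset V W v \<longleftrightarrow> x - v \<in> W"
  using V by (auto simp: vcoset_def concrete_vspace_def intro: exI[of _ "x - v"])

lemma vcoset_self: "v \<in> vcoset V W v"
  by (simp add: vcoset_iff subspace_0[OF W])

lemma vcoset_eq_iff: "vcoset V W u = vcoset V W v \<longleftrightarrow> u - v \<in> W"
proof
  assume "u - v \<in> W"
  moreover have "x - v = (x - u) + (u - v)" "x - u = (x - v) - (u - v)" for x by auto
  ultimately have "x - v \<in> W \<longleftrightarrow> x - u \<in> W" for x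
    using subspace_add[OF W] subspace_diff[OF W] by metis
  then show "vcoset V W u = vcoset V W v" by (auto simp: vcoset_iff)
qed (use vcoset_self[of u] vcoset_iff in auto)

lemma vcoset_add: "vcoset V W (x + y) = vadd (quot_vspace V W) (vcoset V W x) (vcoset V W y)"
proof -
  have add: "vadd V = (+)" using V by (simp add: concrete_vspace_def)
  show ?thesis
  proof (intro equalityI subsetI)
    fix z assume z: "z \<in> vcoset V W (x + y)"
    then have "z - y \<in> vcoset V W x" by (simp add: vcoset_iff algebra_simps)
    then show "z \<in> vadd (quot_vspace V W) (vcoset V W x) (vcoset V W y)"
      using vcoset_self[of y] by (force simp: quot_vspace_def add)
  next
    fix z assume "z \<in> vadd (quot_vspace V W) (vcoset V W x) (vcoset V W y)"
    then obtain a b where w: "a - x \<in> W" "b - y \<in> W" "z = a + b"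
      by (auto simp: quot_vspace_def add vcoset_iff)
    have "z - (x + y) = (a - x) + (b - y)" using w(3) by simp
    then show "z \<in> vcoset V W (x + y)" unfolding vcoset_iff by (metis subspace_add[OF W w(1,2)])
  qed
qed

lemma vcoset_scale: "vcoset V W (vscale V c x) = vscale (quot_vspace V W) c (vcoset V W x)"
proof -
  have add: "vadd V = (+)" using V by (simp add: concrete_vspace_def)
  show ?thesis
  proof (intro equalityI subsetI)
    fix z assume "z \<in> vcoset V W (vscale V c x)"
    then obtain w where w: "w \<in> W" "z = vscale V c x + w" by (auto simp: vcoset_def add)
    then show "z \<in> vscale (quot_vspace V W) c (vcoset V W x)"
      using vcoset_self[of x] by (auto simp: quot_vspace_def add)
  next
    fix z assume "z \<in> vscale (quot_vspace V W) c (vcoset V W x)"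
    then obtain a w where w: "a - x \<in> W" "w \<in> W" "z = vscale V c a + w"
      by (auto simp: quot_vspace_def add vcoset_iff)
    have "z - vscale V c x = vscale V c (a - x) + w" using w(3) by (simp add: scale_right_diff_distrib)
    then show "z \<in> vcoset V W (vscale V c x)"
      unfolding vcoset_iff by (metis subspace_add[OF W subspace_scale[OF W w(1)] w(2)])
  qed
qed

text \<open>The coset of \<open>v\<close> meets \<open>C\<close> exactly in \<open>q v\<close>: two
  points of \<open>C\<close> in one coset differ by an element of \<open>W\<close>, which
  \<open>q\<close> kills, while \<open>q\<close> fixes both points.\<close>

lemma quot_vspace_complement:
  assumes q: "Vector_Spaces.linear (vscale V) (vscale V) q"
    "\<And>w. w \<in> W \<Longrightarrow> q w = 0" "\<And>v. v \<in> vcarrier V \<Longrightarrow> v - q v \<in> W"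
    and C: "C = q ` vcarrier V" "C \<subseteq> vcarrier V" "\<And>v. v \<in> C \<Longrightarrow> q v = v"
  shows "vspace_iso (sub_vspace V C) (quot_vspace V W)"
proof -
  have add: "vadd V = (+)" using V by (auto simp: concrete_vspace_def)
  interpret q: Vector_Spaces.linear "vscale V" "vscale V" q by (rule q(1))
  have "lin_map (sub_vspace V C) (quot_vspace V W) (vcoset V W)"
    using C(2) by (auto simp: lin_map_def vcarrier_quot_vspace vcoset_add vcoset_scale add)
  moreover have "bij_betw (vcoset V W) C (vcarrier (quot_vspace V W))"
    unfolding bij_betw_def
  proof (intro conjI equalityI subsetI)
    show "inj_on (vcoset V W) C"
    proof (rule inj_onI)
      fix x y assume "x \<in> C" "y \<in> C" "vcoset V W x = vcoset V W y"
      then show "x = y" using C(3)[of x] C(3)[of y] q(2)[of "x - y"] by (simp add: vcoset_eq_iff q.diff)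
    qed
    fix z assume "z \<in> vcarrier (quot_vspace V W)"
    then obtain v where "v \<in> vcarrier V" "z = vcoset V W v" by (auto simp: vcarrier_quot_vspace)
    then show "z \<in> vcoset V W ` C" using vcoset_eq_iff[of v "q v"] q(3)[of v] C(1) by auto
  qed (use C(2) in \<open>auto simp: vcarrier_quot_vspace\<close>)
  ultimately show ?thesis by (auto simp: vspace_iso_def)
qed

end

section \<open>Comparing finite dimensions\<close>

lemma dim_le_of_injective:
  assumes V: "concrete_vspace V" and W: "concrete_vspace W"
    and BV: "finite B" "module.span (vscale V) B = vcarrier V"
    and BW: "finite B'" "module.span (vscale W) B' = vcarrier W"
    and \<phi>: "lin_map V W \<phi>" "inj_on \<phi> (vcarrier V)"
  shows "vector_space.dim (vscale V) (vcarrier V) \<le> vector_space.dim (vscale W) (vcarrier W)"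
proof -
  interpret v: vector_space "vscale V" using V by (simp add: concrete_vspace_def)
  interpret w: vector_space "vscale W" using W by (simp add: concrete_vspace_def)
  interpret p: vector_space_pair "vscale V" "vscale W" by unfold_locales
  obtain g where g: "Vector_Spaces.linear (vscale V) (vscale W) g" "\<And>x. x \<in> vcarrier V \<Longrightarrow> g x = \<phi> x"
    using p.linear_on_extend[of "vcarrier V" \<phi>] V W \<phi>(1) by (auto simp: concrete_vspace_def lin_map_def)
  interpret g: Vector_Spaces.linear "vscale V" "vscale W" g by (rule g(1))
  obtain X where X: "X \<subseteq> vcarrier V" "v.independent X" "vcarrier V \<subseteq> v.span X"
    using v.maximal_independent_subset by blast
  have sX: "v.span X = vcarrier V"
    using v.span_subspace[OF X(1,3)] V by (auto simp: concrete_vspace_def)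
  obtain Y where Y: "Y \<subseteq> vcarrier W" "w.independent Y" "vcarrier W \<subseteq> w.span Y"
    using w.maximal_independent_subset by blast
  have sY: "w.span Y = vcarrier W"
    using w.span_subspace[OF Y(1,3)] W by (auto simp: concrete_vspace_def)
  \<comment> \<open>\<open>dim\<close> is the cardinality of a basis, hence 0 for an infinite one,
    so the comparison needs a finite basis of the target.\<close>
  have "finite Y" using w.independent_span_bound[OF BW(1) Y(2)] Y(1) BW(2) by auto
  have inj: "inj_on g (v.span X)" using \<phi>(2) g(2) by (simp add: sX inj_on_def)
  have "w.independent (g ` X)" by (rule g.independent_injective_image[OF X(2) inj])
  moreover have "g ` X \<subseteq> w.span Y" using X(1) g(2) \<phi>(1) sY by (auto simp: lin_map_def)
  ultimately have "card (g ` X) \<le> card Y"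
    using w.independent_span_bound[OF \<open>finite Y\<close>] by blast
  moreover have "card (g ` X) = card X" by (rule card_image) (use inj X(1) sX in \<open>auto intro: inj_on_subset\<close>)
  ultimately show ?thesis
    using v.basis_card_eq_dim[OF X(1,3,2)] w.basis_card_eq_dim[OF Y(1,3,2)] by simp
qed

lemma vspace_iso_of_dim_eq:
  assumes V: "concrete_vspace V" and W: "concrete_vspace W"
    and BV: "finite B" "module.span (vscale V) B = vcarrier V"
    and BW: "finite B'" "module.span (vscale W) B' = vcarrier W"
    and eq: "vector_space.dim (vscale V) (vcarrier V) = vector_space.dim (vscale W) (vcarrier W)"
  shows "vspace_iso V W"
proof -
  interpret v: vector_space "vscale V" using V by (simp add: concrete_vspace_def)
  interpret w: vector_space "vscale W" using W by (simp add: concrete_vspace_def)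
  interpret p: vector_space_pair "vscale V" "vscale W" by unfold_locales
  obtain X where X: "X \<subseteq> vcarrier V" "v.independent X" "vcarrier V \<subseteq> v.span X"
    using v.maximal_independent_subset by blast
  have sX: "v.span X = vcarrier V"
    using v.span_subspace[OF X(1,3)] V by (auto simp: concrete_vspace_def)
  obtain Y where Y: "Y \<subseteq> vcarrier W" "w.independent Y" "vcarrier W \<subseteq> w.span Y"
    using w.maximal_independent_subset by blast
  have sY: "w.span Y = vcarrier W"
    using w.span_subspace[OF Y(1,3)] W by (auto simp: concrete_vspace_def)
  have fX: "finite X" using v.independent_span_bound[OF BV(1) X(2)] X(1) BV(2) by auto
  have fY: "finite Y" using w.independent_span_bound[OF BW(1) Y(2)] Y(1) BW(2) by auto
  obtain g where g: "Vector_Spaces.linear (vscale V) (vscale W) g" "g ` vcarrier V = vcarrier W"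
      "inj_on g (vcarrier V)"
  proof -
    have "card X = card Y" 
      using eq v.basis_card_eq_dim[OF X(1,3,2)] w.basis_card_eq_dim[OF Y(1,3,2)] by simp
    then obtain \<beta> where \<beta>: "bij_betw \<beta> X Y" using fX fY finite_same_card_bij by blast
    obtain g where g: "Vector_Spaces.linear (vscale V) (vscale W) g" "\<forall>x\<in>X. g x = \<beta> x"
      using p.linear_independent_extend[OF X(2)] by blast
    interpret g: Vector_Spaces.linear "vscale V" "vscale W" g by (rule g(1))
    have im: "g ` X = Y" using g(2) \<beta> by (auto simp: bij_betw_def)
    have "inj_on g X" using g(2) \<beta> by (auto simp: bij_betw_def inj_on_def)
    then have "inj_on g (v.span X)" using g.inj_on_span_iff_independent_image[of X] im Y(2) by simp
    then show ?thesis using that[OF g(1)] g.span_image[of X] im sX sY by simp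
  qed
  interpret g: Vector_Spaces.linear "vscale V" "vscale W" g by (rule g(1))
  show ?thesis unfolding vspace_iso_def
    using g V W by (intro exI[of _ g]) (auto simp: bij_betw_def lin_map_def concrete_vspace_def g.add g.scale)
qed

text \<open>Finiteness of \<open>K\<close> is a consequence: a basis \<open>X\<close> of
  \<open>M\<close> is extended to a basis \<open>Y\<close> of \<open>K\<close>, and the image of
  \<open>Y - X\<close> is a basis of the finite-dimensional \<open>L\<close>.\<close>

lemma rank_nullity:
  assumes K: "concrete_vspace K" and L: "concrete_vspace L"
    and BL: "finite BL" "module.span (vscale L) BL = vcarrier L"
    and BM: "finite BM" "module.span (vscale K) BM = M"
    and p: "lin_map K L p" "p ` vcarrier K = vcarrier L" "M = {x \<in> vcarrier K. p x = 0}"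
  shows "vector_space.dim (vscale K) (vcarrier K) =
    vector_space.dim (vscale L) (vcarrier L) + vector_space.dim (vscale K) M"
proof -
  interpret k: vector_space "vscale K" using K by (simp add: concrete_vspace_def)
  interpret l: vector_space "vscale L" using L by (simp add: concrete_vspace_def)
  interpret kl: vector_space_pair "vscale K" "vscale L" by unfold_locales
  interpret kk: vector_space_pair "vscale K" "vscale K" by unfold_locales
  have subK: "k.subspace (vcarrier K)" using K by (simp add: concrete_vspace_def)
  obtain g where g: "Vector_Spaces.linear (vscale K) (vscale L) g" "\<And>x. x \<in> vcarrier K \<Longrightarrow> g x = p x"
    using kl.linear_on_extend[of "vcarrier K" p] K L p(1) by (auto simp: concrete_vspace_def lin_map_def)
  interpret g: Vector_Spaces.linear "vscale K" "vscale L" g by (rule g(1))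
  obtain X where X: "X \<subseteq> M" "k.independent X" "M \<subseteq> k.span X"
    using k.maximal_independent_subset by blast
  have sX: "k.span X = M"
    by (rule k.span_subspace[OF X(1,3)]) (simp add: BM(2)[symmetric])
  obtain Y where Y: "X \<subseteq> Y" "Y \<subseteq> vcarrier K" "k.independent Y" "vcarrier K \<subseteq> k.span Y"
    using k.maximal_independent_subset_extend[OF _ X(2), of "vcarrier K"] X(1) p(3) by blast
  have sY: "k.span Y = vcarrier K" by (rule k.span_subspace[OF Y(2,4) subK])
  have fX: "finite X" using k.independent_span_bound[OF BM(1) X(2)] X(1) BM(2) by auto
  \<comment> \<open>\<open>q\<close> kills the span of \<open>X\<close> and fixes the span of
    \<open>Y - X\<close>, so the two spans meet only in 0.\<close>
  obtain q where q: "Vector_Spaces.linear (vscale K) (vscale K) q" "\<forall>x\<in>Y. q x = (if x \<in> X then 0 else x)"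
    using kk.linear_independent_extend[OF Y(3), of "\<lambda>x. if x \<in> X then 0 else x"] by blast
  interpret q: Vector_Spaces.linear "vscale K" "vscale K" q by (rule q(1))
  let ?Z = "Y - X"
  have indZ: "k.independent ?Z" using Y(3) k.independent_mono by blast
  have injZ: "inj_on g (k.span ?Z)"
    unfolding g.inj_on_iff_eq_0[OF k.subspace_span]
  proof (intro ballI impI)
    fix x assume x: "x \<in> k.span ?Z" "g x = 0"
    have "x \<in> k.span Y" using x k.span_mono[of ?Z Y] by blast
    then have "x \<in> k.span X" using x g(2) sX p(3) sY by auto
    moreover have "q y = 0" if "y \<in> X" for y using that q(2) Y(1) by auto
    ultimately have "q x = 0" using q.eq_0_on_span by blast
    moreover have "q x = x"
      by (rule kk.linear_eq_on[OF q(1) k.linear_ident x(1)]) (use q(2) in auto)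
    ultimately show "x = 0" by simp
  qed
  have ind: "l.independent (g ` ?Z)" by (rule g.independent_injective_image[OF indZ injZ])
  have gX: "g x = 0" if "x \<in> X" for x using that X(1) p(3) g(2) by auto
  have "g ` Y \<subseteq> insert 0 (g ` ?Z)" using gX by auto
  then have "l.span (g ` Y) \<subseteq> l.span (g ` ?Z)"
    using l.span_mono[of "g ` Y" "insert 0 (g ` ?Z)"] by simp
  moreover have "l.span (g ` Y) = vcarrier L" unfolding g.span_image sY using p(2) g(2) by auto
  ultimately have sp: "vcarrier L \<subseteq> l.span (g ` ?Z)" by simp
  have sub: "g ` ?Z \<subseteq> vcarrier L" using Y(2) p(2) g(2) by auto
  have "finite (g ` ?Z)" using l.independent_span_bound[OF BL(1) ind] sub BL(2) by auto
  note inj = inj_on_subset[OF injZ k.span_superset]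
  have fZ: "finite ?Z" by (rule finite_imageD[OF \<open>finite (g ` ?Z)\<close> inj])
  have "card (?Z \<union> X) = card ?Z + card X" by (rule card_Un_disjoint[OF fZ fX]) blast
  moreover have "?Z \<union> X = Y" using Y(1) by blast
  moreover note card_image[OF inj]
  ultimately show ?thesis
    using k.basis_card_eq_dim[OF Y(2,4,3)] k.basis_card_eq_dim[OF X(1,3,2)]
      l.basis_card_eq_dim[OF sub sp ind] by simp
qed

section \<open>Cocycles induced by linear forms\<close>

locale leibniz =
  fixes A :: "('f::field, 'a::ab_group_add) alg"
  assumes leib: "leibniz_algebra A"
begin

sublocale vector_space "vscale A"
  using leib by (simp add: leibniz_algebra_def)

abbreviation car :: "'a set" where "car \<equiv> vcarrier A"

lemma vadd_eq: "vadd A = (+)"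
  using leib by (simp add: leibniz_algebra_def)

lemma subspace_car: "subspace car"
  using leib by (simp add: leibniz_algebra_def)

lemma concrete: "concrete_vspace A"
  by (simp add: concrete_vspace_def vadd_eq subspace_car vector_space_axioms)

lemmas car_add = subspace_add[OF subspace_car]
  and car_scale = subspace_scale[OF subspace_car]
  and car_diff = subspace_diff[OF subspace_car]
  and car_0 = subspace_0[OF subspace_car]

lemma mul_closed: "x \<in> car \<Longrightarrow> y \<in> car \<Longrightarrow> mul A x y \<in> car"
  and mul_add_left: "x \<in> car \<Longrightarrow> y \<in> car \<Longrightarrow> z \<in> car \<Longrightarrow> mul A (x + y) z = mul A x z + mul A y z"
  and mul_add_right: "x \<in> car \<Longrightarrow> y \<in> car \<Longrightarrow> z \<in> car \<Longrightarrow> mul A x (y + z) = mul A x y + mul A x z"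
  and mul_scale_left: "x \<in> car \<Longrightarrow> y \<in> car \<Longrightarrow> mul A (vscale A c x) y = vscale A c (mul A x y)"
  and mul_scale_right: "x \<in> car \<Longrightarrow> y \<in> car \<Longrightarrow> mul A x (vscale A c y) = vscale A c (mul A x y)"
  and mul_mul: "x \<in> car \<Longrightarrow> y \<in> car \<Longrightarrow> z \<in> car \<Longrightarrow>
    mul A x (mul A y z) = mul A (mul A x y) z + mul A y (mul A x z)"
  using leib unfolding leibniz_algebra_def by blast+

lemma mul_zero_left: "y \<in> car \<Longrightarrow> mul A 0 y = 0"
  using mul_scale_left[of 0 y 0] car_0 by simp

lemma mul_zero_right: "y \<in> car \<Longrightarrow> mul A y 0 = 0"
  using mul_scale_right[of y 0 0] car_0 by simp

lemma mul_diff_left: "x \<in> car \<Longrightarrow> y \<in> car \<Longrightarrow> z \<in> car \<Longrightarrow> mul A (x - y) z = mul A x z - mul A y z"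
  using mul_add_left[of "x - y" y z] car_diff by simp

lemma mul_diff_right: "x \<in> car \<Longrightarrow> y \<in> car \<Longrightarrow> z \<in> car \<Longrightarrow> mul A x (y - z) = mul A x y - mul A x z"
  using mul_add_right[of x "y - z" z] car_diff by simp

lemma subspace_prod_span: "subspace (prod_span A S T)"
  by (simp add: prod_span_def)

lemma prod_span_base: "x \<in> S \<Longrightarrow> y \<in> T \<Longrightarrow> mul A x y \<in> prod_span A S T"
  unfolding prod_span_def by (rule span_base) blast

lemma prod_span_minimal:
  "subspace U \<Longrightarrow> (\<And>x y. x \<in> S \<Longrightarrow> y \<in> T \<Longrightarrow> mul A x y \<in> U) \<Longrightarrow> prod_span A S T \<subseteq> U"
  unfolding prod_span_def by (rule span_minimal) auto

lemma subspace_derived: "subspace (derived A)"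
  by (simp add: derived_def subspace_prod_span)

lemma mul_derived: "x \<in> car \<Longrightarrow> y \<in> car \<Longrightarrow> mul A x y \<in> derived A"
  by (simp add: derived_def prod_span_base)

lemma derived_minimal:
  "subspace U \<Longrightarrow> (\<And>x y. x \<in> car \<Longrightarrow> y \<in> car \<Longrightarrow> mul A x y \<in> U) \<Longrightarrow> derived A \<subseteq> U"
  unfolding derived_def by (rule prod_span_minimal)

lemma derived_subset: "derived A \<subseteq> car"
  by (rule derived_minimal[OF subspace_car mul_closed])

end

section \<open>The spaces of cocycles and coboundaries\<close>

definition cocycle_space :: "('f::field, 'a::ab_group_add) alg \<Rightarrow> ('f, 'a \<Rightarrow> 'a \<Rightarrow> 'f) vspace" where
  "cocycle_space L = \<lparr>vcarrier = cocycles2 L, vadd = (\<lambda>f g x y. f x y + g x y),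
     vscale = (\<lambda>c f x y. c * f x y)\<rparr>"

lemma cocycle_space_simps [simp]:
  "vcarrier (cocycle_space L) = cocycles2 L"
  "vadd (cocycle_space L) = (+)"
  "vscale (cocycle_space L) = (\<lambda>c f x y. c * f x y)"
  by (simp_all add: cocycle_space_def fun_eq_iff)

lemma cohomology2_eq: "cohomology2 L = quot_vspace (cocycle_space L) (coboundaries2 L)"
  by (simp add: cohomology2_def cocycle_space_def)

context leibniz
begin

lemma cocyclesI:
  assumes "\<And>x y z. x \<in> car \<Longrightarrow> y \<in> car \<Longrightarrow> z \<in> car \<Longrightarrow> f (x + y) z = f x z + f y z"
    "\<And>x y z. x \<in> car \<Longrightarrow> y \<in> car \<Longrightarrow> z \<in> car \<Longrightarrow> f x (y + z) = f x y + f x z"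
    "\<And>c x y. x \<in> car \<Longrightarrow> y \<in> car \<Longrightarrow> f (vscale A c x) y = c * f x y"
    "\<And>c x y. x \<in> car \<Longrightarrow> y \<in> car \<Longrightarrow> f x (vscale A c y) = c * f x y"
    "\<And>x y z. x \<in> car \<Longrightarrow> y \<in> car \<Longrightarrow> z \<in> car \<Longrightarrow>
      f x (mul A y z) = f (mul A x y) z + f y (mul A x z)"
    "\<And>x y. x \<notin> car \<or> y \<notin> car \<Longrightarrow> f x y = 0"
  shows "f \<in> cocycles2 A"
  unfolding cocycles2_def mem_Collect_eq
  by (intro conjI ballI allI impI) (assumption | rule assms)+

lemma cocyclesD:
  assumes "f \<in> cocycles2 A"
  shows "x \<in> car \<Longrightarrow> y \<in> car \<Longrightarrow> z \<in> car \<Longrightarrow> f (x + y) z = f x z + f y z"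
    "x \<in> car \<Longrightarrow> y \<in> car \<Longrightarrow> z \<in> car \<Longrightarrow> f x (y + z) = f x y + f x z"
    "x \<in> car \<Longrightarrow> y \<in> car \<Longrightarrow> f (vscale A c x) y = c * f x y"
    "x \<in> car \<Longrightarrow> y \<in> car \<Longrightarrow> f x (vscale A c y) = c * f x y"
    "x \<in> car \<Longrightarrow> y \<in> car \<Longrightarrow> z \<in> car \<Longrightarrow>
      f x (mul A y z) = f (mul A x y) z + f y (mul A x z)"
    "x \<notin> car \<or> y \<notin> car \<Longrightarrow> f x y = 0"
  using assms unfolding cocycles2_def by blast+

lemma subspace_cocycles: "module.subspace (\<lambda>c f x y. c * f x y) (cocycles2 A)"
proof -
  interpret f: vector_space "\<lambda>(c::'f) (f :: 'a \<Rightarrow> 'a \<Rightarrow> 'f) x y. c * f x y" by (rule vector_space_fun2)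
  show ?thesis
  proof (rule f.subspaceI)
    show "0 \<in> cocycles2 A" by (rule cocyclesI) simp_all
    show "f + g \<in> cocycles2 A" if "f \<in> cocycles2 A" "g \<in> cocycles2 A" for f g
    proof (rule cocyclesI)
      fix x y z assume "x \<in> car" "y \<in> car" "z \<in> car"
      note jac = cocyclesD(5)[OF that(1) this] cocyclesD(5)[OF that(2) this]
      show "(f + g) x (mul A y z) = (f + g) (mul A x y) z + (f + g) y (mul A x z)"
        by (simp only: plus_fun_apply jac) simp
    qed (use cocyclesD(1-4,6)[OF that(1)] cocyclesD(1-4,6)[OF that(2)] in \<open>simp_all add: algebra_simps\<close>)
    show "(\<lambda>x y. c * f x y) \<in> cocycles2 A" if "f \<in> cocycles2 A" for f c
    proof (rule cocyclesI)
      fix x y z assume "x \<in> car" "y \<in> car" "z \<in> car"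
      note jac = cocyclesD(5)[OF that(1) this]
      show "c * f x (mul A y z) = c * f (mul A x y) z + c * f y (mul A x z)"
        by (simp only: jac distrib_left)
    qed (use cocyclesD(1-4,6)[OF that] in \<open>simp_all add: algebra_simps\<close>)
  qed
qed

lemma concrete_cocycle_space: "concrete_vspace (cocycle_space A)"
  by (simp add: concrete_vspace_def vector_space_fun2 subspace_cocycles)

lemma linear_forms_iff: "\<epsilon> \<in> linear_forms A \<longleftrightarrow>
    (\<forall>x\<in>car. \<forall>y\<in>car. \<epsilon> (x + y) = \<epsilon> x + \<epsilon> y) \<and> (\<forall>c. \<forall>x\<in>car. \<epsilon> (vscale A c x) = c * \<epsilon> x) \<and>
    (\<forall>x. x \<notin> car \<longrightarrow> \<epsilon> x = 0)"
  by (simp add: linear_forms_def lin_map_def ground_vspace_def vadd_eq)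

lemma coboundariesI:
  assumes "f \<in> cocycles2 A" "\<epsilon> \<in> linear_forms A"
    "\<And>x y. x \<in> car \<Longrightarrow> y \<in> car \<Longrightarrow> f x y = - \<epsilon> (mul A x y)"
  shows "f \<in> coboundaries2 A"
  using assms unfolding coboundaries2_def by blast

lemma coboundariesE:
  assumes "f \<in> coboundaries2 A"
  obtains \<epsilon> where "f \<in> cocycles2 A" "\<epsilon> \<in> linear_forms A"
    "\<And>x y. x \<in> car \<Longrightarrow> y \<in> car \<Longrightarrow> f x y = - \<epsilon> (mul A x y)"
  using assms unfolding coboundaries2_def by blast

lemma subspace_coboundaries: "module.subspace (\<lambda>c f x y. c * f x y) (coboundaries2 A)"
proof -
  interpret f: vector_space "\<lambda>(c::'f) (f :: 'a \<Rightarrow> 'a \<Rightarrow> 'f) x y. c * f x y" by (rule vector_space_fun2)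
  show ?thesis
  proof (rule f.subspaceI)
    show "0 \<in> coboundaries2 A"
      by (rule coboundariesI[OF f.subspace_0[OF subspace_cocycles], of "\<lambda>x. 0"])
        (simp_all add: linear_forms_iff)
  next
    fix f g assume "f \<in> coboundaries2 A" "g \<in> coboundaries2 A"
    then obtain \<epsilon> \<eta> where fg: "f \<in> cocycles2 A" "g \<in> cocycles2 A"
      and *: "\<epsilon> \<in> linear_forms A" "\<eta> \<in> linear_forms A"
      "\<And>x y. x \<in> car \<Longrightarrow> y \<in> car \<Longrightarrow> f x y = - \<epsilon> (mul A x y)"
      "\<And>x y. x \<in> car \<Longrightarrow> y \<in> car \<Longrightarrow> g x y = - \<eta> (mul A x y)"
      using coboundariesE by metis
    show "f + g \<in> coboundaries2 A"
      by (rule coboundariesI[OF f.subspace_add[OF subspace_cocycles fg], of "\<lambda>x. \<epsilon> x + \<eta> x"])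
        (use * in \<open>simp_all add: linear_forms_iff algebra_simps\<close>)
  next
    fix c f assume "f \<in> coboundaries2 A"
    then obtain \<epsilon> where f: "f \<in> cocycles2 A"
      and *: "\<epsilon> \<in> linear_forms A" "\<And>x y. x \<in> car \<Longrightarrow> y \<in> car \<Longrightarrow> f x y = - \<epsilon> (mul A x y)"
      by (elim coboundariesE) blast
    show "(\<lambda>x y. c * f x y) \<in> coboundaries2 A"
      by (rule coboundariesI[OF f.subspace_scale[OF subspace_cocycles f], of "\<lambda>x. c * \<epsilon> x"])
        (use * in \<open>simp_all add: linear_forms_iff algebra_simps\<close>)
  qed
qed

lemma cocycle_zero_left: "f \<in> cocycles2 A \<Longrightarrow> f 0 y = 0"
  and cocycle_zero_right: "f \<in> cocycles2 A \<Longrightarrow> f y 0 = 0"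
proof -
  assume f: "f \<in> cocycles2 A"
  show "f 0 y = 0"
  proof (cases "y \<in> car")
    case True
    then show ?thesis using cocyclesD(3)[OF f car_0, of y 0] by simp
  qed (use cocyclesD(6)[OF f] in auto)
  show "f y 0 = 0"
  proof (cases "y \<in> car")
    case True
    then show ?thesis using cocyclesD(4)[OF f _ car_0, of y 0] by simp
  qed (use cocyclesD(6)[OF f] in auto)
qed

end

section \<open>Surjective homomorphisms and the cocycles they induce\<close>

definition hopf_denominator :: "('f::field, 'b::ab_group_add) alg \<Rightarrow> 'b set \<Rightarrow> 'b set" where
  "hopf_denominator F R =
    {a + b | a b. a \<in> prod_span F (vcarrier F) R \<and> b \<in> prod_span F R (vcarrier F)}"

text \<open>Free presentations and defining pairs both give such a \<open>p\<close>. It is linear on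
  the whole type, so that compositions with forms are total linear forms, whereas products and
  surjectivity concern the carriers; hence \<open>N\<close> is the kernel inside the
  carrier.\<close>

locale leibniz_epi = leibniz A + l: leibniz L
  for A :: "('f::field, 'a::ab_group_add) alg" and L :: "('f, 'b::ab_group_add) alg" +
  fixes p :: "'a \<Rightarrow> 'b"
  assumes linear_p: "Vector_Spaces.linear (vscale A) (vscale L) p"
    and p_mul: "x \<in> vcarrier A \<Longrightarrow> y \<in> vcarrier A \<Longrightarrow> p (mul A x y) = mul L (p x) (p y)"
    and p_image: "p ` vcarrier A = vcarrier L"
begin

sublocale p: Vector_Spaces.linear "vscale A" "vscale L" p by (rule linear_p)
sublocale form: vector_space_pair "vscale A" "(*) :: 'f \<Rightarrow> 'f \<Rightarrow> 'f"
  by (rule vector_space_pair_field) (rule vector_space_axioms)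
sublocale lform: vector_space_pair "vscale L" "(*) :: 'f \<Rightarrow> 'f \<Rightarrow> 'f"
  by (rule vector_space_pair_field) (rule l.vector_space_axioms)

definition N :: "'a set" where "N = {x \<in> car. p x = 0}"
definition W :: "'a set" where "W = hopf_denominator A N"

lemma p_car: "x \<in> car \<Longrightarrow> p x \<in> l.car"
  using p_image by blast

lemma subspace_N: "subspace N"
  unfolding N_def using subspace_inter[OF subspace_car p.subspace_kernel] by (simp add: Int_def)

lemma subspace_W: "subspace W"
  unfolding W_def hopf_denominator_def by (intro subspace_sums subspace_prod_span)

lemma mul_W: "x \<in> car \<Longrightarrow> r \<in> N \<Longrightarrow> mul A x r \<in> W" "x \<in> car \<Longrightarrow> r \<in> N \<Longrightarrow> mul A r x \<in> W"
proof -
  assume "x \<in> car" "r \<in> N"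
  then show "mul A x r \<in> W"
    unfolding W_def hopf_denominator_def mem_Collect_eq
    by (intro exI[of _ "mul A x r"] exI[of _ 0])
      (simp add: prod_span_base subspace_0[OF subspace_prod_span])
next
  assume "x \<in> car" "r \<in> N"
  then show "mul A r x \<in> W"
    unfolding W_def hopf_denominator_def mem_Collect_eq
    by (intro exI[of _ "mul A r x"] exI[of _ 0])
      (simp add: prod_span_base subspace_0[OF subspace_prod_span])
qed

lemma W_minimal:
  assumes "subspace U" "\<And>x r. x \<in> car \<Longrightarrow> r \<in> N \<Longrightarrow> mul A x r \<in> U \<and> mul A r x \<in> U"
  shows "W \<subseteq> U"
proof -
  have "prod_span A car N \<subseteq> U" "prod_span A N car \<subseteq> U"
    using assms(2) by (intro prod_span_minimal[OF assms(1)]; blast)+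
  then show ?thesis using subspace_add[OF assms(1)] by (auto simp: W_def hopf_denominator_def)
qed

lemma W_subset: "W \<subseteq> derived A \<inter> N"
proof (rule W_minimal)
  show "subspace (derived A \<inter> N)" by (rule subspace_inter[OF subspace_derived subspace_N])
  show "mul A x r \<in> derived A \<inter> N \<and> mul A r x \<in> derived A \<inter> N" if "x \<in> car" "r \<in> N" for x r
    using that mul_derived mul_closed p_car
    by (auto simp: N_def p_mul l.mul_zero_left l.mul_zero_right)
qed

text \<open>Preimages under \<open>p\<close> are chosen arbitrarily; the value does not depend on
  the choice once \<open>\<epsilon>\<close> vanishes on \<open>W\<close>. The sign is that of the
  convention for coboundaries.\<close>

definition induced :: "('a \<Rightarrow> 'f) \<Rightarrow> 'b \<Rightarrow> 'b \<Rightarrow> 'f" where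
  "induced \<epsilon> = (\<lambda>x y. if x \<in> l.car \<and> y \<in> l.car then
     - \<epsilon> (mul A (inv_into car p x) (inv_into car p y)) else 0)"

text \<open>Replacing one factor at a time by another preimage changes the product by an element of
  \<open>NA\<close> or \<open>AN\<close>, hence of \<open>W\<close>.\<close>

lemma induced_eq:
  assumes \<epsilon>: "Vector_Spaces.linear (vscale A) (*) \<epsilon>" "\<And>w. w \<in> W \<Longrightarrow> \<epsilon> w = 0"
    and x: "x \<in> car" and y: "y \<in> car"
  shows "induced \<epsilon> (p x) (p y) = - \<epsilon> (mul A x y)"
proof -
  interpret e: Vector_Spaces.linear "vscale A" "(*)" \<epsilon> by (rule \<epsilon>(1))
  define s where "s = inv_into car p"
  have s: "s (p z) \<in> car" "s (p z) - z \<in> N" if "z \<in> car" for z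
  proof -
    have "s (p z) \<in> car" "p (s (p z)) = p z"
      using that by (auto simp: s_def inv_into_into f_inv_into_f)
    then show "s (p z) \<in> car" "s (p z) - z \<in> N" using that by (auto simp: N_def car_diff p.diff)
  qed
  have "mul A (s (p x)) (s (p y)) - mul A x y = mul A (s (p x) - x) (s (p y)) + mul A x (s (p y) - y)"
    using s x y by (simp add: mul_diff_left mul_diff_right)
  moreover have "\<dots> \<in> W" by (intro subspace_add[OF subspace_W] mul_W s x y)
  ultimately have "\<epsilon> (mul A (s (p x)) (s (p y)) - mul A x y) = 0" using \<epsilon>(2) by simp
  then show ?thesis using p_car[OF x] p_car[OF y] by (simp add: induced_def s_def e.diff)
qed

lemma induced_unique:
  assumes \<epsilon>: "Vector_Spaces.linear (vscale A) (*) \<epsilon>" "\<And>w. w \<in> W \<Longrightarrow> \<epsilon> w = 0"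
    and f: "f \<in> cocycles2 L" "\<And>x y. x \<in> car \<Longrightarrow> y \<in> car \<Longrightarrow> f (p x) (p y) = - \<epsilon> (mul A x y)"
  shows "induced \<epsilon> = f"
proof (intro ext)
  fix x y
  show "induced \<epsilon> x y = f x y"
  proof (cases "x \<in> l.car \<and> y \<in> l.car")
    case True
    then obtain u v where "u \<in> car" "v \<in> car" "x = p u" "y = p v" using p_image by blast
    then show ?thesis using f(2) induced_eq[OF \<epsilon>] by simp
  qed (use l.cocyclesD(6)[OF f(1)] in \<open>auto simp: induced_def\<close>)
qed

text \<open>With every argument written as \<open>p u\<close>, the cocycle identity is the Leibniz
  identity of \<open>A\<close> with \<open>- \<epsilon>\<close> applied to it, and bilinearity is
  that of the product.\<close>

lemma induced_cocycle:
  assumes \<epsilon>: "Vector_Spaces.linear (vscale A) (*) \<epsilon>" "\<And>w. w \<in> W \<Longrightarrow> \<epsilon> w = 0"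
  shows "induced \<epsilon> \<in> cocycles2 L"
proof -
  interpret e: Vector_Spaces.linear "vscale A" "(*)" \<epsilon> by (rule \<epsilon>(1))
  note ieq = induced_eq[OF \<epsilon>]
  have add: "induced \<epsilon> (p u + p v) (p w) = induced \<epsilon> (p u) (p w) + induced \<epsilon> (p v) (p w)"
    "induced \<epsilon> (p u) (p v + p w) = induced \<epsilon> (p u) (p v) + induced \<epsilon> (p u) (p w)"
    if "u \<in> car" "v \<in> car" "w \<in> car" for u v w
    using that by (simp_all add: p.add[symmetric] ieq car_add mul_add_left mul_add_right e.add)
  have scale: "induced \<epsilon> (vscale L c (p u)) (p v) = c * induced \<epsilon> (p u) (p v)"
    "induced \<epsilon> (p u) (vscale L c (p v)) = c * induced \<epsilon> (p u) (p v)"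
    if "u \<in> car" "v \<in> car" for u v c
    using that by (simp_all add: p.scale[symmetric] ieq car_scale mul_scale_left mul_scale_right e.scale)
  have jac: "induced \<epsilon> (p u) (mul L (p v) (p w)) =
      induced \<epsilon> (mul L (p u) (p v)) (p w) + induced \<epsilon> (p v) (mul L (p u) (p w))"
    if "u \<in> car" "v \<in> car" "w \<in> car" for u v w
    using that by (simp add: p_mul[symmetric] ieq mul_closed mul_mul[of u v w] e.add)
  show ?thesis
  proof (rule l.cocyclesI)
    show "induced \<epsilon> x y = 0" if "x \<notin> l.car \<or> y \<notin> l.car" for x y
      using that by (auto simp: induced_def)
    fix x y z assume "x \<in> l.car" "y \<in> l.car" "z \<in> l.car"
    then obtain u v w where *: "u \<in> car" "v \<in> car" "w \<in> car" "x = p u" "y = p v" "z = p w"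
      unfolding p_image[symmetric] by (elim imageE) (rule that)
    show "induced \<epsilon> (x + y) z = induced \<epsilon> x z + induced \<epsilon> y z"
      "induced \<epsilon> x (y + z) = induced \<epsilon> x y + induced \<epsilon> x z"
      unfolding * by (rule add[OF *(1-3)])+
    show "induced \<epsilon> x (mul L y z) = induced \<epsilon> (mul L x y) z + induced \<epsilon> y (mul L x z)"
      unfolding * by (rule jac[OF *(1-3)])
  next
    fix c x y assume "x \<in> l.car" "y \<in> l.car"
    then obtain u v where *: "u \<in> car" "v \<in> car" "x = p u" "y = p v"
      using p_image by blast
    show "induced \<epsilon> (vscale L c x) y = c * induced \<epsilon> x y"
      "induced \<epsilon> x (vscale L c y) = c * induced \<epsilon> x y"
      unfolding * by (rule scale[OF *(1,2)])+
  qed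
qed

text \<open>If the cocycle comes from a form \<open>\<eta>\<close> on \<open>L\<close>, then
  \<open>\<epsilon>\<close> and \<open>\<eta> \<circ> p\<close> agree on products, hence on
  \<open>A'\<close>, and the latter vanishes on \<open>N\<close>. Conversely, vanishing on
  \<open>A' \<inter> N\<close> lets the restriction of \<open>\<epsilon>\<close> to
  \<open>A'\<close> factor through \<open>p\<close>, and the factor is the required form.\<close>

lemma induced_coboundary_iff:
  assumes \<epsilon>: "Vector_Spaces.linear (vscale A) (*) \<epsilon>" "\<And>w. w \<in> W \<Longrightarrow> \<epsilon> w = 0"
  shows "induced \<epsilon> \<in> coboundaries2 L \<longleftrightarrow> (\<forall>v \<in> derived A \<inter> N. \<epsilon> v = 0)"
proof
  assume "induced \<epsilon> \<in> coboundaries2 L"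
  then obtain \<eta> where \<eta>: "\<eta> \<in> linear_forms L"
    "\<And>x y. x \<in> l.car \<Longrightarrow> y \<in> l.car \<Longrightarrow> induced \<epsilon> x y = - \<eta> (mul L x y)"
    by (elim l.coboundariesE) blast
  obtain g where g: "Vector_Spaces.linear (vscale L) (*) g" "\<And>x. x \<in> l.car \<Longrightarrow> g x = \<eta> x"
    using lform.linear_on_extend[OF l.subspace_car, of \<eta>] \<eta>(1)
    by (auto simp: l.linear_forms_iff)
  have lin: "Vector_Spaces.linear (vscale A) (*) (\<lambda>v. \<epsilon> v - (g \<circ> p) v)"
    by (rule form.linear_compose_sub[OF \<epsilon>(1) Vector_Spaces.linear_compose[OF linear_p g(1)]])
  interpret e: Vector_Spaces.linear "vscale A" "(*)" "\<lambda>v. \<epsilon> v - (g \<circ> p) v" by (rule lin)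
  have "derived A \<subseteq> {v. \<epsilon> v - (g \<circ> p) v = 0}"
  proof (rule derived_minimal[OF e.subspace_kernel])
    fix x y assume xy: "x \<in> car" "y \<in> car"
    then show "mul A x y \<in> {v. \<epsilon> v - (g \<circ> p) v = 0}"
      using \<eta>(2)[OF p_car p_car, of x y] induced_eq[OF \<epsilon> xy] g(2) by (simp add: p_mul l.mul_closed p_car)
  qed
  moreover have "g 0 = 0" using g(1) by (simp add: Vector_Spaces.linear.axioms lform.linear_0)
  ultimately show "\<forall>v \<in> derived A \<inter> N. \<epsilon> v = 0" by (auto simp: N_def)
next
  assume v: "\<forall>v \<in> derived A \<inter> N. \<epsilon> v = 0"
  obtain h where h: "Vector_Spaces.linear (vscale L) (*) h" "\<And>u. u \<in> derived A \<Longrightarrow> h (p u) = \<epsilon> u"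
    using lform.linear_factor[OF linear_p \<epsilon>(1) subspace_derived] v derived_subset by (auto simp: N_def)
  interpret h: Vector_Spaces.linear "vscale L" "(*)" h by (rule h(1))
  define \<eta> where "\<eta> x = (if x \<in> l.car then h x else 0)" for x
  have "\<eta> \<in> linear_forms L"
    by (auto simp: l.linear_forms_iff \<eta>_def l.car_add l.car_scale h.add h.scale)
  moreover have "induced \<epsilon> x y = - \<eta> (mul L x y)" if "x \<in> l.car" "y \<in> l.car" for x y
  proof -
    obtain u v where uv: "u \<in> car" "v \<in> car" "x = p u" "y = p v" using \<open>x \<in> l.car\<close> \<open>y \<in> l.car\<close> p_image by blast
    then show ?thesis
      using induced_eq[OF \<epsilon> uv(1,2)] h(2)[OF mul_derived[OF uv(1,2)]] l.mul_closed[OF that]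
      by (simp add: \<eta>_def p_mul)
  qed
  ultimately show "induced \<epsilon> \<in> coboundaries2 L"
    using l.coboundariesI[OF induced_cocycle[OF \<epsilon>]] by blast
qed

end

text \<open>\<open>C\<close> stands for the quotient of \<open>V\<close> by \<open>W\<close> without
  cosets. The range condition covers the whole type, so that a form given only on \<open>C\<close>
  becomes a total linear form after composition with \<open>q\<close>.\<close>

locale complement_projection =
  fixes s :: "'f::field \<Rightarrow> 'v::ab_group_add \<Rightarrow> 'v" and V W :: "'v set" and q :: "'v \<Rightarrow> 'v" and C :: "'v set"
  assumes linear_q: "Vector_Spaces.linear s s q"
    and range_q: "range q \<subseteq> C"
    and subspace_C: "module.subspace s C"
    and C_subset: "C \<subseteq> V"
    and q_W: "w \<in> W \<Longrightarrow> q w = 0"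
    and diff_q: "v \<in> V \<Longrightarrow> v - q v \<in> W"
    and q_C: "v \<in> C \<Longrightarrow> q v = v"

lemma complement_projection_exists:
  assumes "vector_space s" "module.subspace s V" "module.subspace s W" "W \<subseteq> V"
  obtains q C where "complement_projection s V W q C"
proof -
  interpret vector_space s by fact
  show ?thesis
  proof (rule subspace_complement[OF assms(2-4)])
    fix q assume "Vector_Spaces.linear s s q" "range q \<subseteq> q ` V" "subspace (q ` V)" "q ` V \<subseteq> V"
      "\<And>w. w \<in> W \<Longrightarrow> q w = 0" "\<And>v. v \<in> V \<Longrightarrow> v - q v \<in> W" "\<And>v. v \<in> q ` V \<Longrightarrow> q v = v"
    then have "complement_projection s V W q (q ` V)"
      by (rule complement_projection.intro)
    then show ?thesis by (rule that)
  qed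
qed

context complement_projection
begin

sublocale q: Vector_Spaces.linear s s q by (rule linear_q)

lemma q_mem: "q v \<in> C" using range_q by blast

lemma vspace_iso_quot:
  assumes "concrete_vspace X" "vscale X = s" "vcarrier X = V" "module.subspace s W"
  shows "vspace_iso (sub_vspace X C) (quot_vspace X W)"
proof -
  have "C \<subseteq> q ` V" using q_C C_subset by (metis image_eqI subsetD subsetI)
  then have C_eq: "C = q ` V" using range_q by blast
  show ?thesis
    by (rule quot_vspace_complement[of X W q C], unfold assms(2,3))
      (fact assms linear_q q_W diff_q C_subset q_C C_eq)+
qed

end

section \<open>The pairing between a complement of \<open>W\<close> and cohomology\<close>

context leibniz_epi
begin

text \<open>Preimages \<open>G\<close> of a finite spanning set of \<open>L\<close> span
  \<open>A\<close> modulo \<open>N\<close>. A product with a factor from \<open>N\<close> lies in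
  \<open>W\<close>, so modulo \<open>W\<close> only products of pairs from \<open>G\<close> remain,
  however large \<open>A\<close> is.\<close>

lemma derived_finitely_spanned:
  assumes B: "finite B" "l.span B = l.car"
  obtains P where "finite P" "derived A \<subseteq> span (P \<union> W)"
proof -
  have "B \<subseteq> p ` car" using B(2) l.span_superset p_image by auto
  then obtain G where G: "G \<subseteq> car" "finite G" "B = p ` G"
    using B(1) finite_subset_image by metis
  have sG: "span G \<subseteq> car" by (rule span_minimal[OF G(1) subspace_car])
  have dec: "\<exists>y\<in>span G. x - y \<in> N" if "x \<in> car" for x
  proof -
    have "p x \<in> p ` span G" using p_car[OF that] B(2) G(3) p.span_image by simp
    then obtain y where y: "y \<in> span G" "p x = p y" by blast
    then have "x - y \<in> N" using that sG by (auto simp: N_def p.diff car_diff)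
    then show ?thesis using y(1) by blast
  qed
  define P where "P = (\<lambda>(x, y). mul A x y) ` (G \<times> G)"
  let ?Y = "span (P \<union> W)"
  have GG1: "mul A x y \<in> ?Y" if x: "x \<in> G" and y: "y \<in> span G" for x y
  proof -
    have xc: "x \<in> car" using x G(1) by blast
    have "subspace {y \<in> car. mul A x y \<in> ?Y}"
      by (rule subspaceI) (simp_all add: xc car_0 car_add car_scale mul_zero_right mul_add_right
          mul_scale_right span_zero span_add span_scale)
    moreover have "G \<subseteq> {y \<in> car. mul A x y \<in> ?Y}" using x G(1) by (auto simp: P_def intro: span_base)
    ultimately show ?thesis using y span_minimal by blast
  qed
  have GG: "mul A x y \<in> ?Y" if x: "x \<in> span G" and y: "y \<in> span G" for x y
  proof -
    have yc: "y \<in> car" using y sG by blast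
    have "subspace {x \<in> car. mul A x y \<in> ?Y}"
      by (rule subspaceI) (simp_all add: yc car_0 car_add car_scale mul_zero_left mul_add_left
          mul_scale_left span_zero span_add span_scale)
    moreover have "G \<subseteq> {x \<in> car. mul A x y \<in> ?Y}" using y G(1) GG1 by blast
    ultimately show ?thesis using x span_minimal by blast
  qed
  have WY: "w \<in> ?Y" if "w \<in> W" for w using that by (intro span_base) auto
  have "derived A \<subseteq> ?Y"
  proof (rule derived_minimal[OF subspace_span])
    fix x y assume xy: "x \<in> car" "y \<in> car"
    obtain x' y' where x': "x' \<in> span G" "x - x' \<in> N" and y': "y' \<in> span G" "y - y' \<in> N"
      using dec xy by blast
    have c: "x' \<in> car" "y' \<in> car" using x' y' sG by auto
    have "mul A x y = mul A x' y' + (mul A x' (y - y') + mul A (x - x') y)"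
      using xy c by (simp add: mul_diff_left mul_diff_right)
    then show "mul A x y \<in> ?Y"
      by (simp only:) (intro span_add GG WY mul_W x' y' c xy)
  qed
  moreover have "finite P" using G(2) by (simp add: P_def)
  ultimately show ?thesis using that by blast
qed

text \<open>\<open>q\<close> is linear on the whole type, so it may be applied to all of
  \<open>A'\<close>, although \<open>v - q v \<in> W\<close> is known only on
  \<open>A' \<inter> N\<close>. It kills \<open>W\<close>, and the images of the finitely many
  products span \<open>C\<close>.\<close>

lemma complement_finitely_spanned:
  assumes C: "complement_projection (vscale A) (derived A \<inter> N) W q C"
    and B: "finite B" "l.span B = l.car"
  obtains P where "finite P" "span P = C"
proof -
  interpret c: complement_projection "vscale A" "derived A \<inter> N" W q C by (rule C)
  obtain P where P: "finite P" "derived A \<subseteq> span (P \<union> W)"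
    using derived_finitely_spanned[OF B] by blast
  have "C \<subseteq> q ` derived A" using c.q_C c.C_subset by (metis IntD1 image_eqI subsetD subsetI)
  also have "\<dots> \<subseteq> q ` span (P \<union> W)" using P(2) by blast
  also have "\<dots> = span (q ` (P \<union> W))" by (simp add: c.q.span_image)
  also have "\<dots> \<subseteq> span (insert 0 (q ` P))" using c.q_W by (intro span_mono) auto
  finally have "C \<subseteq> span (q ` P)" by simp
  moreover have "q ` P \<subseteq> C" using c.q_mem by blast
  ultimately have "span (q ` P) = C" using span_subspace c.subspace_C by blast
  then show ?thesis using that P(1) by blast
qed

text \<open>\<open>T\<close> is, on representatives, the map from the dual of the quotient of
  \<open>A' \<inter> N\<close> by \<open>W\<close> to cohomology. Injectivity holds for every
  surjection and gives the bound for defining pairs; surjectivity is conditional on lifting cocycles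
  to forms on \<open>A\<close>, which free algebras provide.\<close>

lemma pairing:
  assumes C: "complement_projection (vscale A) (derived A \<inter> N) W q C"
    and D: "complement_projection (\<lambda>c f x y. c * f x y) (cocycles2 L) (coboundaries2 L) d D"
  obtains T where "lin_map (dual_vspace (sub_vspace A C)) (sub_vspace (cocycle_space L) D) T"
    "inj_on T (linear_forms (sub_vspace A C))"
    "(\<And>f. f \<in> cocycles2 L \<Longrightarrow> \<exists>\<epsilon>. Vector_Spaces.linear (vscale A) (*) \<epsilon> \<and>
        (\<forall>x \<in> car. \<forall>y \<in> car. f (p x) (p y) = - \<epsilon> (mul A x y))) \<Longrightarrow>
      T ` linear_forms (sub_vspace A C) = D"
proof -
  interpret c: complement_projection "vscale A" "derived A \<inter> N" W q C by (rule C)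
  interpret f: vector_space "\<lambda>(c::'f) (f :: 'b \<Rightarrow> 'b \<Rightarrow> 'f) x y. c * f x y" by (rule vector_space_fun2)
  interpret d: complement_projection "\<lambda>c f x y. c * f x y" "cocycles2 L" "coboundaries2 L" d D by (rule D)
  \<comment> \<open>\<open>\<mu> \<circ> q\<close> extends \<open>\<mu>\<close> and vanishes on
    \<open>W\<close>; \<open>d\<close> picks the representative in \<open>D\<close> of the induced
    class.\<close>
  define T where "T \<mu> = d (induced (\<mu> \<circ> q))" for \<mu>
  let ?F = "linear_forms (sub_vspace A C)"
  have F: "\<mu> \<in> ?F \<longleftrightarrow> (\<forall>x\<in>C. \<forall>y\<in>C. \<mu> (x + y) = \<mu> x + \<mu> y) \<and>
      (\<forall>c. \<forall>x\<in>C. \<mu> (vscale A c x) = c * \<mu> x) \<and> (\<forall>x. x \<notin> C \<longrightarrow> \<mu> x = 0)" for \<mu>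
    by (simp add: linear_forms_def lin_map_def ground_vspace_def vadd_eq)
  have lin: "Vector_Spaces.linear (vscale A) (*) (\<mu> \<circ> q)" if "\<mu> \<in> ?F" for \<mu>
    using that c.q_mem vector_space_axioms vector_space_field
    by (simp add: F Vector_Spaces.linear_iff c.q.add c.q.scale)
  have W0: "(\<mu> \<circ> q) w = 0" if "\<mu> \<in> ?F" "w \<in> W" for \<mu> w
  proof -
    interpret e: Vector_Spaces.linear "vscale A" "(*)" "\<mu> \<circ> q" by (rule lin[OF that(1)])
    have "(\<mu> \<circ> q) 0 = 0" by (rule e.zero)
    then show ?thesis using c.q_W[OF that(2)] c.q.zero by simp
  qed
  note coc = induced_cocycle[OF lin W0]
  have diff: "induced (\<lambda>v. \<epsilon> v - \<eta> v) = induced \<epsilon> - induced \<eta>" for \<epsilon> \<eta>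
    by (simp add: induced_def fun_eq_iff)
  \<comment> \<open>Applied to a difference of forms, the coboundary criterion decides when two
    induced cocycles are cohomologous.\<close>
  have cob: "\<forall>v\<in>derived A \<inter> N. \<epsilon> v = \<eta> v"
    if "induced \<epsilon> - induced \<eta> \<in> coboundaries2 L" and
      "Vector_Spaces.linear (vscale A) (*) \<epsilon>" "\<And>w. w \<in> W \<Longrightarrow> \<epsilon> w = 0"
      "Vector_Spaces.linear (vscale A) (*) \<eta>" "\<And>w. w \<in> W \<Longrightarrow> \<eta> w = 0" for \<epsilon> \<eta>
    using induced_coboundary_iff[OF form.linear_compose_sub[OF that(2,4)]] that by (simp add: diff)
  have cob': "induced \<epsilon> - induced \<eta> \<in> coboundaries2 L"
    if "\<And>v. v\<in>derived A \<inter> N \<Longrightarrow> \<epsilon> v = \<eta> v" and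
      "Vector_Spaces.linear (vscale A) (*) \<epsilon>" "\<And>w. w \<in> W \<Longrightarrow> \<epsilon> w = 0"
      "Vector_Spaces.linear (vscale A) (*) \<eta>" "\<And>w. w \<in> W \<Longrightarrow> \<eta> w = 0" for \<epsilon> \<eta>
    using induced_coboundary_iff[OF form.linear_compose_sub[OF that(2,4)]] that by (simp add: diff)
  show ?thesis
  proof (rule that[of T])
    have "T (\<lambda>x. f x + g x) = T f + T g" if "f \<in> ?F" "g \<in> ?F" for f g
    proof -
      have "induced ((\<lambda>x. f x + g x) \<circ> q) = induced (f \<circ> q) + induced (g \<circ> q)"
        by (simp add: induced_def fun_eq_iff)
      then show ?thesis by (simp add: T_def d.q.add)
    qed
    moreover have "T (\<lambda>x. c * f x) = (\<lambda>x y. c * T f x y)" if "f \<in> ?F" for f c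
    proof -
      have "induced ((\<lambda>x. c * f x) \<circ> q) = (\<lambda>x y. c * induced (f \<circ> q) x y)"
        by (simp add: induced_def fun_eq_iff)
      then show ?thesis by (simp add: T_def d.q.scale)
    qed
    ultimately show "lin_map (dual_vspace (sub_vspace A C)) (sub_vspace (cocycle_space L) D) T"
      by (auto simp: lin_map_def dual_vspace_def T_def d.q_mem)
    show "inj_on T ?F"
    proof (rule inj_onI)
      fix f g assume fg: "f \<in> ?F" "g \<in> ?F" "T f = T g"
      have "induced (f \<circ> q) - d (induced (f \<circ> q)) - (induced (g \<circ> q) - d (induced (g \<circ> q))) \<in> coboundaries2 L"
        by (intro f.subspace_diff[OF l.subspace_coboundaries] d.diff_q coc fg)
      then have "induced (f \<circ> q) - induced (g \<circ> q) \<in> coboundaries2 L"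
        using fg(3) by (simp add: T_def)
      then have "\<forall>v\<in>derived A \<inter> N. (f \<circ> q) v = (g \<circ> q) v"
        by (rule cob) (intro lin W0 fg | assumption)+
      then have fgq: "(f \<circ> q) v = (g \<circ> q) v" if "v \<in> C" for v using that c.C_subset by blast
      have fgC: "f v = g v" if "v \<in> C" for v
        using fgq[OF that] c.q_C[OF that] by simp
      show "f = g"
      proof (rule ext)
        show "f v = g v" for v using fgC[of v] fg(1,2) unfolding F by (cases "v \<in> C") simp_all
      qed
    qed
    assume lift: "\<And>f. f \<in> cocycles2 L \<Longrightarrow> \<exists>\<epsilon>. Vector_Spaces.linear (vscale A) (*) \<epsilon> \<and>
        (\<forall>x \<in> car. \<forall>y \<in> car. f (p x) (p y) = - \<epsilon> (mul A x y))"
    have "f \<in> T ` ?F" if "f \<in> D" for f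
    proof -
      have f: "f \<in> cocycles2 L" using that d.C_subset by blast
      obtain \<epsilon> where \<epsilon>: "Vector_Spaces.linear (vscale A) (*) \<epsilon>"
        "\<And>x y. x \<in> car \<Longrightarrow> y \<in> car \<Longrightarrow> f (p x) (p y) = - \<epsilon> (mul A x y)"
        using lift[OF f] by blast
      interpret e: Vector_Spaces.linear "vscale A" "(*)" \<epsilon> by (rule \<epsilon>(1))
      \<comment> \<open>On a product with a factor \<open>r\<close> from \<open>N\<close>, the value
        of \<open>\<epsilon>\<close> is up to sign a value of \<open>f\<close> with
        \<open>p r = 0\<close> as an argument.\<close>
      have "W \<subseteq> {v. \<epsilon> v = 0}"
      proof (rule W_minimal[OF e.subspace_kernel])
        fix x r assume x: "x \<in> car" "r \<in> N"
        then have r: "r \<in> car" "p r = 0" by (auto simp: N_def)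
        then show "mul A x r \<in> {v. \<epsilon> v = 0} \<and> mul A r x \<in> {v. \<epsilon> v = 0}"
          using \<epsilon>(2)[OF x(1) r(1)] \<epsilon>(2)[OF r(1) x(1)] l.cocycle_zero_left[OF f] l.cocycle_zero_right[OF f]
          by simp
      qed
      then have \<epsilon>W: "\<epsilon> w = 0" if "w \<in> W" for w using that by blast
      define \<mu> where "\<mu> x = (if x \<in> C then \<epsilon> x else 0)" for x
      have \<mu>: "\<mu> \<in> ?F"
        by (auto simp: F \<mu>_def subspace_add[OF c.subspace_C] subspace_scale[OF c.subspace_C] e.add e.scale)
      \<comment> \<open>Agreement on \<open>A' \<inter> N\<close> is all that the criterion asks.
        Elsewhere the two forms may differ, and the resulting coboundary is removed by
        \<open>d\<close>.\<close>
      have "(\<mu> \<circ> q) v = \<epsilon> v" if "v \<in> derived A \<inter> N" for v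
        using \<epsilon>W[OF c.diff_q[OF that]] c.q_mem[of v] by (simp add: \<mu>_def e.diff)
      then have "induced (\<mu> \<circ> q) - induced \<epsilon> \<in> coboundaries2 L"
        by (rule cob') (intro lin W0 \<mu> \<epsilon>(1) \<epsilon>W | assumption)+
      then have "induced (\<mu> \<circ> q) - f \<in> coboundaries2 L"
        using induced_unique[OF \<epsilon>(1) \<epsilon>W f \<epsilon>(2)] by simp
      then have "d (induced (\<mu> \<circ> q) - f) = 0" by (rule d.q_W)
      then have "T \<mu> = f" using d.q_C[OF that] by (simp add: T_def d.q.diff)
      then show ?thesis using \<mu> by blast
    qed
    then show "T ` ?F = D" by (auto simp: T_def d.q_mem)
  qed
qed

end

section \<open>Central extensions\<close>

text \<open>The extension of \<open>A\<close> by a family \<open>g\<close> of cocycles, realised on functions: the coordinates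
  outside \<open>I\<close> encode an element of \<open>A\<close> through the forms \<open>r k\<close>, those in \<open>I\<close> are the central part.\<close>

locale central_extension = leibniz A
  for A :: "('f::field, 'a::ab_group_add) alg" +
  fixes r :: "'j \<Rightarrow> 'a \<Rightarrow> 'f" and I :: "'j set" and g :: "'j \<Rightarrow> 'a \<Rightarrow> 'a \<Rightarrow> 'f"
  assumes linear_r: "Vector_Spaces.linear (vscale A) (*) (r k)"
    and separating: "x \<in> vcarrier A \<Longrightarrow> (\<And>k. k \<notin> I \<Longrightarrow> r k x = 0) \<Longrightarrow> x = 0"
    and cocycle_g: "k \<in> I \<Longrightarrow> g k \<in> cocycles2 A"
begin

sublocale r: Vector_Spaces.linear "vscale A" "(*)" "r k" for k by (rule linear_r)

text \<open>The projection of the extension onto \<open>A\<close>: by \<open>separating\<close>, the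
  element encoded in the coordinates outside \<open>I\<close> is unique.\<close>

definition q :: "('j \<Rightarrow> 'f) \<Rightarrow> 'a" where
  "q w = (THE x. x \<in> car \<and> (\<forall>k. k \<notin> I \<longrightarrow> w k = r k x))"

text \<open>This is \<open>A\<close> plus one copy of the field for each index in \<open>I\<close>,
  with the twisted product \<open>(x, a) (y, b) = (xy, g x y)\<close>, where \<open>g x y\<close>
  collects the values \<open>g k x y\<close>.\<close>

definition K :: "('f, 'j \<Rightarrow> 'f) alg" where
  "K = \<lparr>vcarrier = {w. \<exists>x \<in> car. \<forall>k. k \<notin> I \<longrightarrow> w k = r k x}, vadd = (+), vscale = (\<lambda>c w k. c * w k),
        mul = (\<lambda>u v k. if k \<in> I then g k (q u) (q v) else r k (mul A (q u) (q v)))\<rparr>"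

text \<open>The linear section of \<open>q\<close> with central part 0. What it lacks to be
  multiplicative is given by the values of the cocycles \<open>g k\<close>.\<close>

definition J :: "'a \<Rightarrow> 'j \<Rightarrow> 'f" where "J x k = (if k \<in> I then 0 else r k x)"

lemma K_simps [simp]: "vadd K = (+)" "vscale K = (\<lambda>c w k. c * w k)"
  "mul K u v = (\<lambda>k. if k \<in> I then g k (q u) (q v) else r k (mul A (q u) (q v)))"
  by (simp_all add: K_def)

lemma q_eq:
  assumes "x \<in> car" "\<And>k. k \<notin> I \<Longrightarrow> w k = r k x"
  shows "q w = x"
  unfolding q_def
proof (rule the_equality)
  fix y assume "y \<in> car \<and> (\<forall>k. k \<notin> I \<longrightarrow> w k = r k y)"
  then have "y - x = 0" using assms by (intro separating) (auto simp: car_diff r.diff)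
  then show "y = x" by simp
qed (use assms in auto)

lemma K_iff: "w \<in> vcarrier K \<longleftrightarrow> (\<exists>x \<in> car. \<forall>k. k \<notin> I \<longrightarrow> w k = r k x)"
  by (simp add: K_def)

lemma q_car: "w \<in> vcarrier K \<Longrightarrow> q w \<in> car"
  using q_eq by (auto simp: K_iff)

lemma q_coord: "w \<in> vcarrier K \<Longrightarrow> k \<notin> I \<Longrightarrow> w k = r k (q w)"
  using q_eq by (auto simp: K_iff)

lemma K_I: "x \<in> car \<Longrightarrow> (\<And>k. k \<notin> I \<Longrightarrow> w k = r k x) \<Longrightarrow> w \<in> vcarrier K"
  by (auto simp: K_iff)

lemma q_add: "u \<in> vcarrier K \<Longrightarrow> v \<in> vcarrier K \<Longrightarrow> q (u + v) = q u + q v"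
  by (rule q_eq) (simp_all add: q_car car_add r.add q_coord)

lemma q_scale: "u \<in> vcarrier K \<Longrightarrow> q (\<lambda>k. c * u k) = vscale A c (q u)"
  by (rule q_eq) (simp_all add: q_car car_scale r.scale q_coord)

lemma q_mul: "u \<in> vcarrier K \<Longrightarrow> v \<in> vcarrier K \<Longrightarrow> q (mul K u v) = mul A (q u) (q v)"
  by (rule q_eq) (simp_all add: q_car mul_closed)

lemma q_J: "x \<in> car \<Longrightarrow> q (J x) = x"
  by (rule q_eq) (simp_all add: J_def)

lemma J_K: "x \<in> car \<Longrightarrow> J x \<in> vcarrier K"
  by (rule K_I) (simp_all add: J_def)

text \<open>In a coordinate from \<open>I\<close> the Leibniz identity is the cocycle identity of
  \<open>g k\<close>; in any other it is the identity of \<open>A\<close> read through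
  \<open>r k\<close>.\<close>

lemma leibniz_K: "leibniz_algebra K"
proof -
  interpret f: vector_space "\<lambda>(c::'f) (f :: 'j \<Rightarrow> 'f) x. c * f x" by (rule vector_space_fun)
  note g = cocyclesD[OF cocycle_g]
  have add: "u + v \<in> vcarrier K" if "u \<in> vcarrier K" "v \<in> vcarrier K" for u v
    by (rule K_I[of "q u + q v"]) (use that in \<open>simp_all add: q_car car_add r.add q_coord\<close>)
  have scale: "(\<lambda>k. c * u k) \<in> vcarrier K" if "u \<in> vcarrier K" for c u
    by (rule K_I[of "vscale A c (q u)"]) (use that in \<open>simp_all add: q_car car_scale r.scale q_coord\<close>)
  have mult: "mul K u v \<in> vcarrier K" if "u \<in> vcarrier K" "v \<in> vcarrier K" for u v
    by (rule K_I[of "mul A (q u) (q v)"]) (use that in \<open>simp_all add: q_car mul_closed\<close>)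
  have sub: "f.subspace (vcarrier K)"
    by (rule f.subspaceI) (use add scale K_I[of 0 0] car_0 in \<open>auto simp: r.zero\<close>)
  have jac: "mul K u (mul K v w) = mul K (mul K u v) w + mul K v (mul K u w)"
    if "u \<in> vcarrier K" "v \<in> vcarrier K" "w \<in> vcarrier K" for u v w
  proof (rule ext)
    fix k
    have q: "q u \<in> car" "q v \<in> car" "q w \<in> car" using that q_car by auto
    show "mul K u (mul K v w) k = (mul K (mul K u v) w + mul K v (mul K u w)) k"
      using mul_mul[OF q] g(5)[OF _ q, of k] r.add[of k]
      by (simp only: q_mul[OF that(1,2)] q_mul[OF that(2,3)] q_mul[OF that(1,3)] K_simps(3)[of u "mul K v w"]
        K_simps(3)[of "mul K u v" w] K_simps(3)[of v "mul K u w"] plus_fun_apply split: if_split) simp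
  qed
  have dist: "mul K (u + v) w = mul K u w + mul K v w" "mul K u (v + w) = mul K u v + mul K u w"
    if "u \<in> vcarrier K" "v \<in> vcarrier K" "w \<in> vcarrier K" for u v w
    using that by (auto simp: fun_eq_iff q_add q_car g(1,2) mul_add_left mul_add_right r.add)
  have hom: "mul K (\<lambda>k. c * u k) v = (\<lambda>k. c * mul K u v k)" "mul K u (\<lambda>k. c * v k) = (\<lambda>k. c * mul K u v k)"
    if "u \<in> vcarrier K" "v \<in> vcarrier K" for u v c
    using that by (auto simp: fun_eq_iff q_scale q_car g(3,4) mul_scale_left mul_scale_right r.scale)
  show ?thesis
    unfolding leibniz_algebra_def K_simps(1,2)
    by (intro conjI ballI allI vector_space_fun refl sub) (rule mult dist hom jac; assumption)+
qed

lemma hom_q: "alg_hom K A q"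
  unfolding alg_hom_def lin_map_def
  using q_car q_add q_scale q_mul by (simp add: vadd_eq)

end

section \<open>Freeness and the splitting of central extensions\<close>

lemma alg_hom_compose: "alg_hom A B \<phi> \<Longrightarrow> alg_hom B C \<psi> \<Longrightarrow> alg_hom A C (\<psi> \<circ> \<phi>)"
  by (simp add: alg_hom_def lin_map_def)

text \<open>Without central coordinates nothing obstructs multiplicativity of the section, and
  \<open>K\<close> is a copy of \<open>A\<close> among functions on the index type.\<close>

lemma (in central_extension) hom_J:
  assumes "I = {}"
  shows "alg_hom A K J"
proof -
  have notin: "k \<notin> I" for k using assms by blast
  then have "J x = (\<lambda>k. r k x)" for x by (simp add: J_def fun_eq_iff)
  note J = this[abs_def]
  show ?thesis
    unfolding alg_hom_def lin_map_def
    using J_K q_J by (auto simp: J notin fun_eq_iff vadd_eq r.add r.scale)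
qed

lemma free_leibniz_lift:
  fixes F :: "('f::field, 'b::ab_group_add) alg"
  assumes "free_leibniz_on F X" "leibniz_algebra (B :: ('f, 'b list \<Rightarrow> 'f) alg)" "\<forall>x\<in>X. g x \<in> vcarrier B"
  obtains \<phi> where "alg_hom F B \<phi>" "\<forall>x\<in>X. \<phi> x = g x"
  using assms unfolding free_leibniz_on_def by blast

lemma free_leibniz_unique:
  fixes F :: "('f::field, 'b::ab_group_add) alg"
  assumes "free_leibniz_on F X" "leibniz_algebra (B :: ('f, 'b list \<Rightarrow> 'f) alg)"
    "alg_hom F B \<phi>" "alg_hom F B \<psi>" "\<forall>x\<in>X. \<phi> x = \<psi> x" "x \<in> vcarrier F"
  shows "\<phi> x = \<psi> x"
proof -
  have X: "X \<subseteq> vcarrier F" using assms(1) unfolding free_leibniz_on_def by (elim conjE)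
  have "\<forall>x\<in>X. \<psi> x \<in> vcarrier B" using X assms(4) unfolding alg_hom_def lin_map_def by blast
  then have "\<forall>\<phi> \<chi>. alg_hom F B \<phi> \<and> alg_hom F B \<chi> \<and> (\<forall>x \<in> X. \<phi> x = \<psi> x \<and> \<chi> x = \<psi> x)
          \<longrightarrow> (\<forall>x \<in> vcarrier F. \<phi> x = \<chi> x)"
    using assms(1,2) unfolding free_leibniz_on_def by (elim conjE) (drule spec[of _ B], blast)
  then show ?thesis using assms(3-6) by blast
qed

text \<open>Sending generators into the extension by the section gives a homomorphism
  \<open>\<phi>\<close> that splits \<open>e.q\<close>. Comparing central coordinates in
  \<open>\<phi> (xy) = \<phi> x \<phi> y\<close> shows that \<open>\<phi> (xy)\<close> has central
  coordinate \<open>f x y\<close>.\<close>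

lemma free_cocycle_lift:
  fixes F :: "('f::field, 'b::ab_group_add) alg"
  assumes free: "free_leibniz_on F X" and f: "f \<in> cocycles2 F"
  obtains \<epsilon> where "Vector_Spaces.linear (vscale F) (*) \<epsilon>"
    "\<And>x y. x \<in> vcarrier F \<Longrightarrow> y \<in> vcarrier F \<Longrightarrow> f x y = - \<epsilon> (mul F x y)"
proof -
  interpret F: leibniz F by unfold_locales (use free in \<open>simp add: free_leibniz_on_def\<close>)
  interpret form: vector_space_pair "vscale F" "(*)"
    by (rule vector_space_pair_field) (rule F.vector_space_axioms)
  have X: "X \<subseteq> F.car" using free by (simp add: free_leibniz_on_def)
  define E where "E = F.extend_basis {}"
  have E: "F.independent E" "F.span E = UNIV"
    by (simp_all add: E_def F.independent_extend_basis F.independent_empty)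
  \<comment> \<open>The index type is dictated by the test algebras. One-letter words carry the
    coordinates in the basis \<open>E\<close>, and the empty word is kept free for the central
    coordinate.\<close>
  define r where "r k x = (if length k = 1 then F.representation E x (hd k) else 0)" for k :: "'b list" and x
  have lin: "Vector_Spaces.linear (vscale F) (*) (r k)" for k
    using F.vector_space_axioms vector_space_field
    by (simp add: Vector_Spaces.linear_iff r_def F.representation_add F.representation_scale E)
  have sep: "x = 0" if "\<And>k. k \<noteq> [] \<Longrightarrow> r k x = 0" for x
  proof -
    have "F.representation E x b = 0" for b using that[of "[b]"] by (simp add: r_def)
    then show ?thesis using F.sum_nonzero_representation_eq[OF E(1), of x] E(2) by simp
  qed
  interpret e: central_extension F r "{[]}" "\<lambda>_. f"
    by (rule central_extension.intro[OF F.leibniz_axioms central_extension_axioms.intro])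
      (use lin sep f in auto)
  interpret e0: central_extension F r "{}" "\<lambda>_. f"
    by (rule central_extension.intro[OF F.leibniz_axioms central_extension_axioms.intro])
      (use lin sep f in auto)
  \<comment> \<open>\<open>e0.K\<close> is a copy of \<open>F\<close> in the type of the test algebras, needed to apply uniqueness to
    endomorphisms of \<open>F\<close>.\<close>
  obtain \<phi> where \<phi>: "alg_hom F e.K \<phi>" "\<forall>x\<in>X. \<phi> x = e.J x"
    by (rule free_leibniz_lift[OF free e.leibniz_K, of e.J]) (use e.J_K X in auto)
  have "alg_hom F e0.K (e0.J \<circ> (e.q \<circ> \<phi>))"
    by (intro alg_hom_compose[OF _ e0.hom_J] alg_hom_compose[OF \<phi>(1) e.hom_q] refl)
  then have J: "(e0.J \<circ> (e.q \<circ> \<phi>)) x = e0.J x" if "x \<in> F.car" for x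
    by (rule free_leibniz_unique[OF free e0.leibniz_K _ e0.hom_J[OF refl] _ that])
      (use \<phi>(2) X e.q_J in auto)
  have \<phi>K: "\<phi> x \<in> vcarrier e.K" if "x \<in> F.car" for x
    using \<phi>(1) that unfolding alg_hom_def lin_map_def by blast
  have q: "e.q (\<phi> x) = x" if "x \<in> F.car" for x
    using arg_cong[OF J[OF that], of e0.q] that by (simp add: e0.q_J e.q_car \<phi>K)
  \<comment> \<open>The central coordinate of the splitting, with the sign required by the
    convention for coboundaries.\<close>
  obtain \<epsilon> where \<epsilon>: "Vector_Spaces.linear (vscale F) (*) \<epsilon>" "\<And>x. x \<in> F.car \<Longrightarrow> \<epsilon> x = - \<phi> x []"
    using form.linear_on_extend[OF F.subspace_car, of "\<lambda>x. - \<phi> x []"] \<phi>(1)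
    by (auto simp: alg_hom_def lin_map_def F.vadd_eq)
  have "f x y = - \<epsilon> (mul F x y)" if "x \<in> F.car" "y \<in> F.car" for x y
  proof -
    have "\<phi> (mul F x y) = mul e.K (\<phi> x) (\<phi> y)" using \<phi>(1) that by (simp add: alg_hom_def)
    then show ?thesis using \<epsilon>(2)[OF F.mul_closed[OF that]] q that by simp
  qed
  then show ?thesis using that \<epsilon>(1) by blast
qed

section \<open>Defining pairs\<close>

lemma leibniz_epi_of_hom:
  assumes A: "leibniz_algebra A" and L: "leibniz_algebra L"
    and \<pi>: "alg_hom A L \<pi>" "\<pi> ` vcarrier A = vcarrier L"
  obtains p where "leibniz_epi A L p" "\<And>x. x \<in> vcarrier A \<Longrightarrow> p x = \<pi> x"
proof -
  interpret A: leibniz A by unfold_locales (rule A)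
  interpret L: leibniz L by unfold_locales (rule L)
  interpret vector_space_pair "vscale A" "vscale L" by unfold_locales
  obtain p where p: "Vector_Spaces.linear (vscale A) (vscale L) p" "\<And>x. x \<in> A.car \<Longrightarrow> p x = \<pi> x"
    using linear_on_extend[OF A.subspace_car, of \<pi>] \<pi>(1)
    by (auto simp: alg_hom_def lin_map_def A.vadd_eq L.vadd_eq)
  have "leibniz_epi A L p"
    by (rule leibniz_epi.intro[OF A.leibniz_axioms L.leibniz_axioms leibniz_epi_axioms.intro[OF p(1)]])
      (use p(2) \<pi> A.mul_closed in \<open>auto simp: alg_hom_def\<close>)
  then show ?thesis using that p(2) by blast
qed

lemma (in leibniz_epi) pullback_cocycle:
  assumes f: "f \<in> cocycles2 L"
  shows "(\<lambda>x y. if x \<in> car \<and> y \<in> car then f (p x) (p y) else 0) \<in> cocycles2 A"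
proof (rule cocyclesI)
  fix x y z assume *: "x \<in> car" "y \<in> car" "z \<in> car"
  then show "(if x \<in> car \<and> mul A y z \<in> car then f (p x) (p (mul A y z)) else 0) =
    (if mul A x y \<in> car \<and> z \<in> car then f (p (mul A x y)) (p z) else 0) +
    (if y \<in> car \<and> mul A x z \<in> car then f (p y) (p (mul A x z)) else 0)"
    using l.cocyclesD(5)[OF f p_car[OF *(1)] p_car[OF *(2)] p_car[OF *(3)]]
    by (simp add: mul_closed p_mul)
qed (use l.cocyclesD(1-4)[OF f] p_car in \<open>auto simp: car_add car_scale p.add p.scale\<close>)

section \<open>Central quotients, and defining pairs as surjections\<close>

context leibniz
begin

text \<open>Changing the factors by central elements does not change the product at all, so the
  setwise product of two cosets, enlarged by \<open>M\<close>, is a single coset.\<close>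

lemma vcoset_mul:
  assumes M: "subspace M" "M \<subseteq> center A" and x: "x \<in> car" and y: "y \<in> car"
  shows "mul (quot_alg A M) (vcoset A M x) (vcoset A M y) = vcoset A M (mul A x y)"
proof -
  have mult: "mul A b c = mul A x y" if "b - x \<in> M" "c - y \<in> M" for b c
  proof -
    have m: "b - x \<in> center A" "c - y \<in> center A" using that M(2) by auto
    then have "b \<in> car" "c \<in> car"
      using car_add[of "b - x" x] car_add[of "c - y" y] x y by (auto simp: center_def)
    then have "mul A b c - mul A x y = mul A (b - x) c + mul A x (c - y)"
      using x y by (simp add: mul_diff_left mul_diff_right)
    then show ?thesis using m \<open>c \<in> car\<close> x by (simp add: center_def)
  qed
  show ?thesis
  proof (intro equalityI subsetI)
    fix z assume "z \<in> mul (quot_alg A M) (vcoset A M x) (vcoset A M y)"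
    then show "z \<in> vcoset A M (mul A x y)"
      by (auto simp: quot_alg_def vcoset_iff[OF concrete M(1)] mult vadd_eq)
  next
    fix z assume "z \<in> vcoset A M (mul A x y)"
    then show "z \<in> mul (quot_alg A M) (vcoset A M x) (vcoset A M y)"
      using vcoset_self[OF concrete M(1)] by (force simp: quot_alg_def vcoset_def)
  qed
qed

lemma quot_alg_simps:
  "vcarrier (quot_alg A M) = vcoset A M ` car"
  "vadd (quot_alg A M) = vadd (quot_vspace A M)"
  "vscale (quot_alg A M) = vscale (quot_vspace A M)"
  by (simp_all add: quot_alg_def vcarrier_quot_vspace)

end

text \<open>The projection of \<open>K\<close> onto its quotient by \<open>M\<close> is followed by
  the inverse of the given isomorphism \<open>\<phi>\<close>. Identities for this composite
  \<open>\<pi>\<close> are checked after applying \<open>\<phi>\<close>, which is injective.\<close>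

lemma defining_pair_epi:
  assumes L: "leibniz_algebra L" and KM: "defining_pair L K M"
  obtains p where "leibniz_epi K L p" "M = {x \<in> vcarrier K. p x = 0}"
proof -
  have lK: "leibniz_algebra K" using KM by (simp add: defining_pair_def)
  interpret K: leibniz K by unfold_locales (rule lK)
  interpret L: leibniz L by unfold_locales (rule L)
  have M: "K.subspace M" "M \<subseteq> center K" using KM by (auto simp: defining_pair_def)
  obtain \<phi> where \<phi>: "alg_hom L (quot_alg K M) \<phi>" "bij_betw \<phi> L.car (vcarrier (quot_alg K M))"
    using KM by (auto simp: defining_pair_def alg_iso_def)
  have inj: "inj_on \<phi> L.car" and im: "\<phi> ` L.car = vcoset K M ` K.car"
    using \<phi>(2) by (auto simp: bij_betw_def K.quot_alg_simps)
  define \<pi> where "\<pi> x = inv_into L.car \<phi> (vcoset K M x)" for x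
  have \<pi>: "\<pi> x \<in> L.car" "\<phi> (\<pi> x) = vcoset K M x" if "x \<in> K.car" for x
  proof -
    have "vcoset K M x \<in> \<phi> ` L.car" using that im by blast
    then show "\<pi> x \<in> L.car" "\<phi> (\<pi> x) = vcoset K M x"
      unfolding \<pi>_def by (rule inv_into_into, rule f_inv_into_f)
  qed
  note coset = vcoset_add[OF K.concrete M(1)] vcoset_scale[OF K.concrete M(1)] K.vcoset_mul[OF M]
  note hom = \<phi>(1)[unfolded alg_hom_def lin_map_def K.quot_alg_simps L.vadd_eq]
  have add: "\<pi> (x + y) = \<pi> x + \<pi> y" if "x \<in> K.car" "y \<in> K.car" for x y
    by (rule inj_onD[OF inj]) (use that hom \<pi> coset in \<open>simp_all add: K.car_add L.car_add\<close>)
  have scale: "\<pi> (vscale K c x) = vscale L c (\<pi> x)" if "x \<in> K.car" for x c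
    by (rule inj_onD[OF inj]) (use that hom \<pi> coset in \<open>simp_all add: K.car_scale L.car_scale\<close>)
  have mult: "\<pi> (mul K x y) = mul L (\<pi> x) (\<pi> y)" if "x \<in> K.car" "y \<in> K.car" for x y
    by (rule inj_onD[OF inj]) (use that hom \<pi> coset in \<open>simp_all add: K.mul_closed L.mul_closed\<close>)
  have "y \<in> \<pi> ` K.car" if y: "y \<in> L.car" for y
  proof -
    obtain x where x: "x \<in> K.car" "\<phi> y = vcoset K M x" using imageI[OF y, of \<phi>] unfolding im by blast
    have "y = \<pi> x" by (rule inj_onD[OF inj _ y \<pi>(1)[OF x(1)]]) (simp add: x(2) \<pi>(2)[OF x(1)])
    then show ?thesis using x by blast
  qed
  then have surj: "\<pi> ` K.car = L.car" using \<pi>(1) by blast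
  have "alg_hom K L \<pi>"
    using add scale mult \<pi>(1) by (simp add: alg_hom_def lin_map_def K.vadd_eq L.vadd_eq)
  then obtain p where p: "leibniz_epi K L p" "\<And>x. x \<in> K.car \<Longrightarrow> p x = \<pi> x"
    using leibniz_epi_of_hom[OF lK L _ surj] by blast
  have \<pi>0: "\<pi> 0 = 0" using scale[of 0 0] K.car_0 by simp
  have "\<pi> x = 0 \<longleftrightarrow> x \<in> M" if "x \<in> K.car" for x
  proof -
    have "\<pi> x = 0 \<longleftrightarrow> \<phi> (\<pi> x) = \<phi> (\<pi> 0)"
      using inj_on_eq_iff[OF inj \<pi>(1)[OF that] \<pi>(1)[OF K.car_0]] \<pi>0 by simp
    then show ?thesis using \<pi>(2)[OF that] \<pi>(2)[OF K.car_0] vcoset_eq_iff[OF K.concrete M(1), of x 0] by simp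
  qed
  moreover have "M \<subseteq> K.car" using M(2) by (auto simp: center_def)
  ultimately have "M = {x \<in> K.car. p x = 0}" using p(2) by auto
  then show ?thesis using that p(1) by blast
qed

context leibniz_epi
begin

text \<open>Preimages of a point of \<open>L\<close> differ by elements of \<open>N\<close>, so the
  coset of a preimage is well defined and determines the point; centrality of \<open>N\<close> makes
  the product of cosets the coset of the product.\<close>

lemma defining_pairI:
  assumes N: "N \<subseteq> center A \<inter> derived A"
  shows "defining_pair L A N"
proof -
  have c: "N \<subseteq> center A" using N by blast
  define \<phi> where "\<phi> y = vcoset A N (inv_into car p y)" for y
  have \<phi>: "\<phi> (p x) = vcoset A N x" if "x \<in> car" for x
  proof -
    have "inv_into car p (p x) \<in> car" "p (inv_into car p (p x)) = p x"
      using that by (auto simp: inv_into_into f_inv_into_f)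
    then show ?thesis
      using that by (simp add: \<phi>_def vcoset_eq_iff[OF concrete subspace_N]) (simp add: N_def car_diff p.diff)
  qed
  note coset = vcoset_add[OF concrete subspace_N] vcoset_scale[OF concrete subspace_N]
    vcoset_mul[OF subspace_N c]
  have "\<phi> (p x + p y) = vadd (quot_vspace A N) (\<phi> (p x)) (\<phi> (p y))"
    "\<phi> (mul L (p x) (p y)) = mul (quot_alg A N) (\<phi> (p x)) (\<phi> (p y))" if "x \<in> car" "y \<in> car" for x y
    using that by (simp_all add: p.add[symmetric] p_mul[symmetric] \<phi> car_add mul_closed coset)
  moreover have "\<phi> (vscale L c (p x)) = vscale (quot_vspace A N) c (\<phi> (p x))" if "x \<in> car" for x c
    using that by (simp add: p.scale[symmetric] \<phi> car_scale coset)
  ultimately have "alg_hom L (quot_alg A N) \<phi>"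
    unfolding alg_hom_def lin_map_def quot_alg_simps p_image[symmetric] l.vadd_eq
    by (auto simp: \<phi>)
  moreover have "bij_betw \<phi> l.car (vcarrier (quot_alg A N))"
    unfolding bij_betw_def quot_alg_simps p_image[symmetric]
  proof
    show "inj_on \<phi> (p ` car)"
    proof (rule inj_onI, elim imageE)
      fix u v x y assume "\<phi> u = \<phi> v" "u = p x" "x \<in> car" "v = p y" "y \<in> car"
      then show "u = v" by (simp add: \<phi> vcoset_eq_iff[OF concrete subspace_N]) (simp add: N_def p.diff)
    qed
    show "\<phi> ` p ` car = vcoset A N ` car" using \<phi> by (auto simp: image_image)
  qed
  ultimately show ?thesis
    using N leib subspace_N by (auto simp: defining_pair_def alg_iso_def)
qed

end

section \<open>The dimension bound for defining pairs and its attainment\<close>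

lemma fin_dim_of_span:
  assumes V: "concrete_vspace V" and P: "finite P" "module.span (vscale V) P = vcarrier V"
  shows "fin_dim V"
proof -
  interpret vector_space "vscale V" using V by (simp add: concrete_vspace_def)
  have add: "vadd V = (+)" using V by (simp add: concrete_vspace_def)
  have "S = vcarrier V" if S: "S \<noteq> {}" "P \<subseteq> S" "S \<subseteq> vcarrier V"
    "\<forall>x\<in>S. \<forall>y\<in>S. x + y \<in> S" "\<forall>c. \<forall>x\<in>S. vscale V c x \<in> S" for S
  proof -
    obtain x where "x \<in> S" using S(1) by blast
    then have "vscale V 0 x \<in> S" using S(5) by blast
    then have "subspace S" by (intro subspaceI S(4)[rule_format] S(5)[rule_format]) simp_all
    then have "span P \<subseteq> S" by (rule span_minimal[OF S(2)])
    then show ?thesis using P(2) S(3) by simp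
  qed
  moreover have "P \<subseteq> vcarrier V" using span_superset[of P] P(2) by simp
  ultimately show ?thesis
    unfolding fin_dim_def add using P(1) by (intro exI[of _ P] conjI allI impI) (assumption | elim conjE)+
qed

lemma vspace_closed_dual:
  assumes "concrete_vspace V"
  shows "vspace_closed (dual_vspace V)"
  using assms concrete_vspace_closed[OF assms]
  by (auto simp: vspace_closed_def dual_vspace_def linear_forms_def lin_map_def ground_vspace_def
      concrete_vspace_def algebra_simps)

lemma fin_dim_dual_iso:
  assumes V: "concrete_vspace V" and fin: "fin_dim V"
  shows "vspace_iso V (dual_vspace V)"
  using fin_dim_basis[OF V fin] dual_fin_dim_iso[OF V] by metis

text \<open>\<open>D\<close> represents the cohomology space. As \<open>W = 0\<close>, the
  complement \<open>C\<close> in the pairing is all of \<open>M\<close>, which is therefore finitely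
  spanned; so \<open>M\<close> is isomorphic to its dual, and the dual embeds in
  \<open>D\<close>.\<close>

lemma defining_pair_dim:
  fixes L :: "('f::field, 'a::ab_group_add) alg" and K :: "('f, 'k::ab_group_add) alg"
  assumes L: "leibniz_algebra L" "fin_dim L" and KM: "defining_pair L K M"
    and D: "complement_projection (\<lambda>c f x y. c * f x y) (cocycles2 L) (coboundaries2 L) d D"
      "fin_dim (sub_vspace (cocycle_space L) D)"
  shows "vector_space.dim (vscale K) (vcarrier K) =
      vector_space.dim (vscale L) (vcarrier L) + vector_space.dim (vscale K) M"
    and "vector_space.dim (vscale K) M \<le> vector_space.dim (\<lambda>c f x y. c * f x y) D"
    and "fin_dim (sub_vspace K M)"
proof -
  obtain p where p: "leibniz_epi K L p" "M = {x \<in> vcarrier K. p x = 0}"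
    using defining_pair_epi[OF L(1) KM] by blast
  interpret leibniz_epi K L p by (rule p(1))
  interpret d: complement_projection "\<lambda>c f x y. c * f x y" "cocycles2 L" "coboundaries2 L" d D by (rule D(1))
  have NM: "N = M" by (simp add: N_def p(2))
  have M: "M \<subseteq> center K" "M \<subseteq> derived K" using KM by (auto simp: defining_pair_def)
  have "W \<subseteq> {0}"
    by (rule W_minimal) (use M(1) in \<open>auto simp: NM center_def\<close>)
  then have W: "W = {0}" using subspace_0[OF subspace_W] by blast
  have V: "derived K \<inter> N = M" using M(2) NM by blast
  obtain q C where C: "complement_projection (vscale K) (derived K \<inter> N) W q C"
    by (rule complement_projection_exists[OF vector_space_axioms
        subspace_inter[OF subspace_derived subspace_N] subspace_W W_subset])
  interpret c: complement_projection "vscale K" "derived K \<inter> N" W q C by (rule C)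
  have CM: "C = M"
  proof
    show "C \<subseteq> M" using c.C_subset V by simp
    show "M \<subseteq> C"
    proof
      fix m assume "m \<in> M"
      then have "q m = m" using c.diff_q[of m] by (simp add: V W)
      then show "m \<in> C" using c.q_mem[of m] by simp
    qed
  qed
  obtain BL where BL: "finite BL" "l.span BL = l.car"
    using fin_dim_basis[OF l.concrete L(2)] by metis
  obtain P where P: "finite P" "span P = M"
    by (rule complement_finitely_spanned[OF C BL, unfolded CM])
  have lin: "lin_map K L p"
    by (simp add: lin_map_def vadd_eq l.vadd_eq p_car p.add p.scale)
  show "vector_space.dim (vscale K) (vcarrier K) =
      vector_space.dim (vscale L) (vcarrier L) + vector_space.dim (vscale K) M"
    by (rule rank_nullity[OF concrete l.concrete BL P lin p_image p(2)])
  have cM: "concrete_vspace (sub_vspace K M)"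
    using concrete_vspace_sub[OF concrete subspace_N] by (simp add: NM)
  show fM: "fin_dim (sub_vspace K M)" by (rule fin_dim_of_span[OF cM P(1)]) (simp add: P(2))
  have cD: "concrete_vspace (sub_vspace (cocycle_space L) D)"
    using concrete_vspace_sub[OF l.concrete_cocycle_space] d.subspace_C by simp
  obtain T where T: "lin_map (dual_vspace (sub_vspace K M)) (sub_vspace (cocycle_space L) D) T"
    "inj_on T (linear_forms (sub_vspace K M))"
    using pairing[OF C D(1)] CM by metis
  obtain \<phi> where \<phi>: "lin_map (sub_vspace K M) (dual_vspace (sub_vspace K M)) \<phi>"
    "bij_betw \<phi> M (linear_forms (sub_vspace K M))"
    using fin_dim_dual_iso[OF cM fM] by (auto simp: vspace_iso_def dual_vspace_def)
  have "inj_on (T \<circ> \<phi>) M"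
    using comp_inj_on[of \<phi> M T] \<phi>(2) T(2) by (auto simp: bij_betw_def)
  moreover obtain Q where Q: "finite Q" "module.span (\<lambda>c f x y. c * f x y) Q = D"
    using fin_dim_basis[OF cD D(2)] by auto
  ultimately show "vector_space.dim (vscale K) M \<le> vector_space.dim (\<lambda>c f x y. c * f x y) D"
    using dim_le_of_injective[OF cM cD P(1) _ Q(1) _ lin_map_compose[OF \<phi>(1) T(1)]] P(2) Q(2) by simp
qed

text \<open>The extension is taken by a basis of \<open>D\<close>, with one central index below
  \<open>n\<close> for each basis cocycle. The kernel of the projection then consists of the
  functions supported below \<open>n\<close>.\<close>

lemma cover_exists:
  fixes L :: "('f::field, 'a::ab_group_add) alg"
  assumes L: "leibniz_algebra L" "fin_dim L"
    and D: "complement_projection (\<lambda>c f x y. c * f x y) (cocycles2 L) (coboundaries2 L) d D"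
      "fin_dim (sub_vspace (cocycle_space L) D)"
  obtains K :: "('f, nat \<Rightarrow> 'f) alg" and M where "defining_pair L K M"
    "vector_space.dim (\<lambda>c f x y. c * f x y) D \<le> vector_space.dim (vscale K) M"
proof -
  interpret L: leibniz L by unfold_locales (rule L)
  interpret f: vector_space "\<lambda>(c::'f) (f :: 'a \<Rightarrow> 'a \<Rightarrow> 'f) x y. c * f x y" by (rule vector_space_fun2)
  interpret s: vector_space "\<lambda>(c::'f) (w :: nat \<Rightarrow> 'f) k. c * w k" by (rule vector_space_fun)
  interpret d: complement_projection "\<lambda>c f x y. c * f x y" "cocycles2 L" "coboundaries2 L" d D by (rule D(1))
  have cD: "concrete_vspace (sub_vspace (cocycle_space L) D)"
    using concrete_vspace_sub[OF L.concrete_cocycle_space] d.subspace_C by simp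
  obtain BL where BL: "finite BL" "L.independent BL" "L.span BL = L.car"
    using fin_dim_basis[OF L.concrete L(2)] by metis
  obtain BD where BD: "finite BD" "f.independent BD" "f.span BD = D"
    using fin_dim_basis[OF cD D(2)] by auto
  obtain h :: "nat \<Rightarrow> 'a" and m where h: "BL = h ` {i. i < m}"
    using finite_imp_nat_seg_image_inj_on[OF BL(1)] by blast
  obtain n and f :: "nat \<Rightarrow> 'a \<Rightarrow> 'a \<Rightarrow> 'f" where f: "BD = f ` {i. i < n}" "inj_on f {i. i < n}"
    using finite_imp_nat_seg_image_inj_on[OF BD(1)] by metis
  have fD: "f i \<in> D" if "i < n" for i
    using that f(1) BD(3) f.span_superset[of BD] by auto
  define E where "E = L.extend_basis BL"
  have E: "L.independent E" "L.span E = UNIV" "BL \<subseteq> E"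
    using L.independent_extend_basis[OF BL(2)] L.extend_basis_superset[OF BL(2)] L.span_extend_basis[OF BL(2)]
    by (simp_all add: E_def)
  \<comment> \<open>The coordinates of \<open>L\<close> are moved past the central ones: index
    \<open>n + i\<close> reads the coefficient at \<open>h i\<close>.\<close>
  define r where "r k x = L.representation E x (h (k - n))" for k x
  have lin: "Vector_Spaces.linear (vscale L) (*) (r k)" for k
    using L.vector_space_axioms vector_space_field
    by (simp add: Vector_Spaces.linear_iff r_def L.representation_add L.representation_scale E)
  have sep: "x = 0" if x: "x \<in> L.car" "\<And>k. k \<notin> {..<n} \<Longrightarrow> r k x = 0" for x
  proof -
    have 0: "L.representation BL x b = 0" for b
    proof (cases "b \<in> BL")
      case True
      then obtain i where "b = h i" using h by blast
      then have "L.representation E x b = 0" using x(2)[of "n + i"] by (simp add: r_def)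
      then show ?thesis using L.representation_extend[OF E(1) _ E(3), of x] x(1) BL(3) by simp
    qed (use L.representation_ne_zero in blast)
    then show ?thesis using L.sum_nonzero_representation_eq[OF BL(2), of x] x(1) BL(3) by simp
  qed
  interpret e: central_extension L r "{..<n}" f
    by (rule central_extension.intro[OF L.leibniz_axioms central_extension_axioms.intro])
      (use lin sep fD d.C_subset in auto)
  interpret K: leibniz e.K by unfold_locales (rule e.leibniz_K)
  have "e.q ` K.car = L.car"
    using e.q_car e.J_K e.q_J by (auto simp: image_iff) (metis e.q_J)
  then obtain p where p: "leibniz_epi e.K L p" "\<And>x. x \<in> K.car \<Longrightarrow> p x = e.q x"
    using leibniz_epi_of_hom[OF e.leibniz_K L(1) e.hom_q] by blast
  interpret p: leibniz_epi e.K L p by (rule p(1))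
  have M_iff: "w \<in> p.N \<longleftrightarrow> (\<forall>k. k \<notin> {..<n} \<longrightarrow> w k = 0)" for w
  proof
    assume "w \<in> p.N"
    then have "w \<in> K.car" "e.q w = 0" using p(2) by (auto simp: p.N_def)
    then show "\<forall>k. k \<notin> {..<n} \<longrightarrow> w k = 0" using e.q_coord[of w] by (simp add: e.r.zero)
  next
    assume w: "\<forall>k. k \<notin> {..<n} \<longrightarrow> w k = 0"
    then have "w \<in> K.car" "e.q w = 0"
      by (auto intro!: e.K_I[OF L.car_0] e.q_eq[OF L.car_0] simp: e.r.zero)
    then show "w \<in> p.N" using p(2) by (simp add: p.N_def)
  qed
  have center: "p.N \<subseteq> center e.K"
  proof
    fix w assume "w \<in> p.N"
    then have w: "w \<in> K.car" "e.q w = 0" using p(2) by (auto simp: p.N_def)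
    show "w \<in> center e.K"
      using w fD d.C_subset L.cocycle_zero_left L.cocycle_zero_right
      by (auto simp: center_def fun_eq_iff e.q_car L.mul_zero_left L.mul_zero_right e.r.zero subset_iff)
  qed
  define \<delta> :: "nat \<Rightarrow> nat \<Rightarrow> 'f" where "\<delta> i k = (if k = i then 1 else 0)" for i k
  have derived: "p.N \<subseteq> derived e.K"
  proof (rule ccontr)
    assume "\<not> p.N \<subseteq> derived e.K"
    then obtain w where w: "w \<in> p.N" "w \<notin> derived e.K" by blast
    have "s.subspace (derived e.K)" using K.subspace_derived by simp
    then obtain \<psi> where \<psi>: "Vector_Spaces.linear (\<lambda>(c::'f) (w :: nat \<Rightarrow> 'f) k. c * w k) (*) \<psi>"
      "\<And>x. x \<in> derived e.K \<Longrightarrow> \<psi> x = 0" "\<psi> w \<noteq> 0"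
      using s.subspace_separation[OF _ w(2)] by metis
    interpret psi: Vector_Spaces.linear "\<lambda>(c::'f) (w :: nat \<Rightarrow> 'f) k. c * w k" "(*)" \<psi> by (rule \<psi>(1))
    have expand: "(\<Sum>i<n. (\<lambda>k. a i * \<delta> i k)) = (\<lambda>k. if k < n then a k else 0)" for a
    proof
      fix k
      have "(\<Sum>i<n. (\<lambda>k. a i * \<delta> i k)) k = (\<Sum>i<n. a i * \<delta> i k)"
        by (induction n) simp_all
      also have "\<dots> = (\<Sum>i<n. if i = k then a i else 0)"
        by (intro sum.cong) (auto simp: \<delta>_def)
      finally show "(\<Sum>i<n. (\<lambda>k. a i * \<delta> i k)) k = (if k < n then a k else 0)" by simp
    qed
    have \<psi>_sum: "\<psi> (\<lambda>k. if k < n then a k else 0) = (\<Sum>i<n. a i * \<psi> (\<delta> i))" for a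
      unfolding expand[symmetric] by (simp add: psi.sum psi.scale)
    \<comment> \<open>The coefficients are the values of \<open>\<psi>\<close> on the standard basis
      of the kernel, so that \<open>\<psi>\<close> turns the central part of a product into a value
      of \<open>\<chi>\<close>.\<close>
    define \<chi> where "\<chi> = (\<Sum>i<n. (\<lambda>x y. \<psi> (\<delta> i) * f i x y))"
    have \<chi>_apply: "\<chi> x y = (\<Sum>i<n. \<psi> (\<delta> i) * f i x y)" for x y
      unfolding \<chi>_def by (induction n) simp_all
    have \<chi>D: "\<chi> \<in> D"
      unfolding \<chi>_def
      by (rule f.subspace_sum[OF d.subspace_C]) (simp add: f.subspace_scale[OF d.subspace_C fD])
    define \<epsilon> where "\<epsilon> x = (if x \<in> L.car then \<psi> (e.J x) else 0)" for x
    have J: "e.J (x + y) = e.J x + e.J y" "e.J (vscale L c x) = (\<lambda>k. c * e.J x k)" for x y c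
      by (auto simp: e.J_def fun_eq_iff e.r.add e.r.scale)
    have "\<epsilon> \<in> linear_forms L"
      by (auto simp: L.linear_forms_iff \<epsilon>_def J L.car_add L.car_scale psi.add psi.scale)
    moreover have "\<chi> x y = - \<epsilon> (mul L x y)" if "x \<in> L.car" "y \<in> L.car" for x y
    proof -
      \<comment> \<open>The section is multiplicative up to the central part. Since
        \<open>\<psi>\<close> kills the product on the left, \<open>\<chi>\<close> is expressed
        through \<open>\<psi> \<circ> e.J\<close>, a form on \<open>L\<close>.\<close>
      have "mul e.K (e.J x) (e.J y) = e.J (mul L x y) + (\<lambda>k. if k < n then f k x y else 0)"
        using that by (auto simp: fun_eq_iff e.q_J) (auto simp: e.J_def)
      moreover have "\<psi> (mul e.K (e.J x) (e.J y)) = 0"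
        using that by (intro \<psi>(2) K.mul_derived e.J_K)
      ultimately have "\<psi> (e.J (mul L x y)) + (\<Sum>i<n. f i x y * \<psi> (\<delta> i)) = 0"
        by (simp only: psi.add \<psi>_sum)
      then show ?thesis using that
        by (simp add: \<chi>_apply \<epsilon>_def L.mul_closed mult.commute add_eq_0_iff)
    qed
    ultimately have "\<chi> \<in> coboundaries2 L"
      using \<chi>D d.C_subset by (intro L.coboundariesI) auto
    \<comment> \<open>\<open>D\<close> meets the coboundaries only in 0, as \<open>d\<close> fixes
      \<open>D\<close> and kills coboundaries.\<close>
    then have "\<chi> = 0" using d.q_W d.q_C[OF \<chi>D] by simp
    \<comment> \<open>Independence of \<open>BD\<close> concerns sums over the set itself, so the
      injective enumeration \<open>f\<close> is inverted.\<close>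
    moreover have "\<chi> = (\<Sum>b\<in>BD. (\<lambda>x y. \<psi> (\<delta> (inv_into {i. i < n} f b)) * b x y))"
      unfolding f(1) using f(2) by (simp add: \<chi>_def sum.reindex lessThan_def)
    ultimately have ind: "\<psi> (\<delta> (inv_into {i. i < n} f b)) = 0" if "b \<in> BD" for b
      using f.independentD[OF BD(2,1) order_refl _ that, of "\<lambda>b. \<psi> (\<delta> (inv_into {i. i < n} f b))"] by simp
    have "\<psi> (\<delta> i) = 0" if "i < n" for i
      using ind[of "f i"] that f by simp
    moreover have "w = (\<lambda>k. if k < n then w k else 0)" using w(1) by (auto simp: M_iff)
    ultimately have "\<psi> w = 0" using \<psi>_sum[of w] by simp
    then show False using \<psi>(3) by simp
  qed
  have pair: "defining_pair L e.K p.N"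
    using center derived by (intro p.defining_pairI) blast
  have fM: "fin_dim (sub_vspace e.K p.N)" by (rule defining_pair_dim(3)[OF L pair D])
  have cM: "concrete_vspace (sub_vspace e.K p.N)"
    by (rule concrete_vspace_sub[OF K.concrete p.subspace_N])
  obtain P where P: "finite P" "s.span P = p.N"
    by (rule fin_dim_basis[OF cM fM]) simp
  \<comment> \<open>Coordinates with respect to \<open>BD\<close>, stored at the central indices,
    embed \<open>D\<close> in the kernel.\<close>
  define \<phi> where "\<phi> g = (\<lambda>k. if k < n then f.representation BD g (f k) else 0)" for g
  have "lin_map (sub_vspace (cocycle_space L) D) (sub_vspace e.K p.N) \<phi>"
    using BD by (auto simp: lin_map_def M_iff \<phi>_def fun_eq_iff f.representation_add f.representation_scale)
  moreover have "inj_on \<phi> D"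
  proof (rule inj_onI)
    fix g g' assume g: "g \<in> D" "g' \<in> D" "\<phi> g = \<phi> g'"
    have "f.representation BD g b = f.representation BD g' b" if b: "b \<in> BD" for b
    proof -
      obtain i where "i < n" "b = f i" using b f(1) by auto
      then show ?thesis using fun_cong[OF g(3), of i] by (simp add: \<phi>_def)
    qed
    then have "(\<Sum>b\<in>BD. (\<lambda>x y. f.representation BD g b * b x y)) =
        (\<Sum>b\<in>BD. (\<lambda>x y. f.representation BD g' b * b x y))" by simp
    then show "g = g'"
      using f.sum_representation_eq[OF BD(2) _ BD(1) order_refl] g(1,2) BD(3) by simp
  qed
  ultimately have "f.dim D \<le> s.dim p.N"
    using dim_le_of_injective[OF cD cM BD(1) _ P(1)] BD(3) P(2) by simp
  then show ?thesis using that pair by simp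
qed

section \<open>Assembling the isomorphisms\<close>

lemma hopf_quotient_eq:
  "hopf_quotient F R = quot_vspace (sub_vspace F (derived F \<inter> R)) (hopf_denominator F R)"
  by (simp add: hopf_quotient_def hopf_denominator_def)

theorem theorem3p6:
  fixes L :: "('f::field, 'a::ab_group_add) alg"
    and F :: "('f, 'b::ab_group_add) alg"
    and R :: "'b set"
    and \<pi> :: "'b \<Rightarrow> 'a"
  assumes "leibniz_algebra L"
    and "free_presentation R F \<pi> L"
  shows "vspace_iso (cohomology2 L) (dual_vspace (hopf_quotient F R)) \<and>
    (fin_dim (hopf_quotient F R) \<longrightarrow> vspace_iso (cohomology2 L) (hopf_quotient F R)) \<and>
    (fin_dim L \<longrightarrow>
      vspace_iso (cohomology2 L) (hopf_quotient F R) \<and>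
      (\<exists>(K :: ('f, nat \<Rightarrow> 'f) alg) M. maximal_defining_pair L K M) \<and>
      (\<forall>(K :: ('f, 'k::ab_group_add) alg) M. maximal_defining_pair L K M \<longrightarrow>
         vspace_iso (sub_vspace K M) (cohomology2 L)))"
proof -
  obtain X where free: "free_leibniz_on F X" and \<pi>: "alg_hom F L \<pi>" "\<pi> ` vcarrier F = vcarrier L"
    and R: "R = {x \<in> vcarrier F. \<pi> x = 0}"
    using assms(2) by (auto simp: free_presentation_def)
  have lF: "leibniz_algebra F" using free by (simp add: free_leibniz_on_def)
  obtain p where p: "leibniz_epi F L p" "\<And>x. x \<in> vcarrier F \<Longrightarrow> p x = \<pi> x"
    using leibniz_epi_of_hom[OF lF assms(1) \<pi>] by blast
  interpret leibniz_epi F L p by (rule p(1))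
  have NR: "N = R" using p(2) by (auto simp: N_def R)
  obtain q C where C: "complement_projection (vscale F) (derived F \<inter> N) W q C"
    by (rule complement_projection_exists[OF vector_space_axioms
        subspace_inter[OF subspace_derived subspace_N] subspace_W W_subset])
  interpret c: complement_projection "vscale F" "derived F \<inter> N" W q C by (rule C)
  obtain d D where D: "complement_projection (\<lambda>c f x y. c * f x y) (cocycles2 L) (coboundaries2 L) d D"
    by (rule complement_projection_exists[OF vector_space_fun2 l.subspace_cocycles l.subspace_coboundaries])
      (auto simp: coboundaries2_def)
  interpret d: complement_projection "\<lambda>c f x y. c * f x y" "cocycles2 L" "coboundaries2 L" d D by (rule D)
  let ?C = "sub_vspace F C" and ?D = "sub_vspace (cocycle_space L) D" and ?H = "hopf_quotient F R"
  have cC: "concrete_vspace ?C" by (rule concrete_vspace_sub[OF concrete c.subspace_C])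
  have cD: "concrete_vspace ?D"
    using concrete_vspace_sub[OF l.concrete_cocycle_space] d.subspace_C by simp
  have CH: "vspace_iso ?C ?H"
  proof -
    have "concrete_vspace (sub_vspace F (derived F \<inter> N))"
      by (intro concrete_vspace_sub concrete subspace_inter subspace_derived subspace_N)
    from c.vspace_iso_quot[OF this _ _ subspace_W] show ?thesis
      by (simp add: hopf_quotient_eq NR[symmetric] W_def)
  qed
  have "vspace_iso ?D (cohomology2 L)"
    using d.vspace_iso_quot[OF l.concrete_cocycle_space _ _ l.subspace_coboundaries]
    by (simp add: cohomology2_eq)
  note DH = this vspace_iso_sym[OF this concrete_vspace_closed[OF cD]]
  have "vspace_iso (dual_vspace ?C) ?D"
  proof (rule pairing[OF C D])
    fix T assume T: "lin_map (dual_vspace ?C) ?D T" "inj_on T (linear_forms ?C)"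
      "(\<And>f. f \<in> cocycles2 L \<Longrightarrow> \<exists>\<epsilon>. Vector_Spaces.linear (vscale F) (*) \<epsilon> \<and>
        (\<forall>x \<in> car. \<forall>y \<in> car. f (p x) (p y) = - \<epsilon> (mul F x y))) \<Longrightarrow> T ` linear_forms ?C = D"
    have "T ` linear_forms ?C = D"
    proof (rule T(3))
      fix f assume "f \<in> cocycles2 L"
      then obtain \<epsilon> where "Vector_Spaces.linear (vscale F) (*) \<epsilon>"
        "\<And>x y. x \<in> car \<Longrightarrow> y \<in> car \<Longrightarrow> (if x \<in> car \<and> y \<in> car then f (p x) (p y) else 0) = - \<epsilon> (mul F x y)"
        using free_cocycle_lift[OF free pullback_cocycle] by metis
      then show "\<exists>\<epsilon>. Vector_Spaces.linear (vscale F) (*) \<epsilon> \<and>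
        (\<forall>x \<in> car. \<forall>y \<in> car. f (p x) (p y) = - \<epsilon> (mul F x y))" by (intro exI[of _ \<epsilon>]) auto
    qed
    then show ?thesis
      using T(1,2) by (auto simp: vspace_iso_def bij_betw_def dual_vspace_def)
  qed
  note CD = this vspace_iso_sym[OF this vspace_closed_dual[OF cC]]
  have coh: "vspace_iso (cohomology2 L) (dual_vspace ?C)"
    by (rule vspace_iso_trans[OF DH(2) CD(2)])
  \<comment> \<open>The dual is removed here: a finite-dimensional \<open>C\<close> is isomorphic to
    its dual.\<close>
  have fin: "vspace_iso (cohomology2 L) ?C" if "fin_dim ?C"
    using fin_dim_dual_iso[OF cC that] vspace_iso_sym concrete_vspace_closed[OF cC] coh vspace_iso_trans
    by blast
  have finL: "fin_dim ?C" if L: "fin_dim L"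
  proof -
    obtain BL where BL: "finite BL" "l.span BL = l.car"
      using fin_dim_basis[OF l.concrete L] by metis
    obtain P where "finite P" "span P = C"
      by (rule complement_finitely_spanned[OF C BL])
    then show ?thesis using fin_dim_of_span[OF cC] by simp
  qed
  have "vspace_iso (cohomology2 L) (dual_vspace ?H)"
    by (rule vspace_iso_trans[OF coh dual_vspace_iso[OF CH concrete_vspace_closed[OF cC]]])
  moreover have "vspace_iso (cohomology2 L) ?H" if "fin_dim ?H"
    using vspace_iso_trans[OF fin CH] fin_dim_iso[OF CH concrete_vspace_closed[OF cC] that] by blast
  moreover have "vspace_iso (cohomology2 L) ?H" if "fin_dim L"
    using vspace_iso_trans[OF fin CH] finL[OF that] by blast
  moreover have "(\<exists>(K :: ('f, nat \<Rightarrow> 'f) alg) M. maximal_defining_pair L K M) \<and>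
      (\<forall>(K :: ('f, 'k::ab_group_add) alg) M. maximal_defining_pair L K M \<longrightarrow>
         vspace_iso (sub_vspace K M) (cohomology2 L))" if L: "fin_dim L"
  proof -
    \<comment> \<open>Finite dimension of the cohomology space comes from the free side, where
      \<open>C\<close> is finitely spanned once \<open>L\<close> is.\<close>
    have "vspace_iso ?D ?C" by (rule vspace_iso_trans[OF DH(1) fin[OF finL[OF L]]])
    then have fD: "fin_dim ?D" by (rule fin_dim_iso[OF _ concrete_vspace_closed[OF cD] finL[OF L]])
    note dim = defining_pair_dim[OF assms(1) L _ D fD]
    obtain K0 :: "('f, nat \<Rightarrow> 'f) alg" and M0 where K0: "defining_pair L K0 M0"
      "vector_space.dim (\<lambda>c f x y. c * f x y) D \<le> vector_space.dim (vscale K0) M0"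
      by (rule cover_exists[OF assms(1) L D fD])
    have "maximal_defining_pair L K0 M0"
      unfolding maximal_defining_pair_def
    proof (intro conjI allI impI K0(1))
      fix K1 :: "('f, nat \<Rightarrow> 'f) alg" and M1 assume K1: "defining_pair L K1 M1"
      show "vector_space.dim (vscale K1) (vcarrier K1) \<le> vector_space.dim (vscale K0) (vcarrier K0)"
        using dim(1,2)[OF K1] dim(1)[OF K0(1)] K0(2) by linarith
    qed
    moreover have "vspace_iso (sub_vspace K M) (cohomology2 L)"
      if max: "maximal_defining_pair L K M" for K :: "('f, 'k) alg" and M
    proof -
      have K: "defining_pair L K M" using max by (simp add: maximal_defining_pair_def)
      \<comment> \<open>\<open>K0\<close> lives in the type over which maximality quantifies, so it
        bounds \<open>K\<close> from below whatever the carrier type of \<open>K\<close>.\<close>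
      have "vector_space.dim (vscale K0) (vcarrier K0) \<le> vector_space.dim (vscale K) (vcarrier K)"
        using max K0(1) unfolding maximal_defining_pair_def by blast
      \<comment> \<open>Both dimensions contain that of \<open>L\<close>. Cancelling it gives
        \<open>dim M \<ge> dim M0 \<ge> dim D\<close>, and the bound for defining pairs gives the
        reverse.\<close>
      then have eq: "vector_space.dim (vscale K) M = vector_space.dim (\<lambda>c f x y. c * f x y) D"
        using dim(1,2)[OF K] dim(1)[OF K0(1)] K0(2) by linarith
      have cM: "concrete_vspace (sub_vspace K M)"
        using K by (auto simp: defining_pair_def leibniz_algebra_def concrete_vspace_def)
      obtain BM where BM: "finite BM" "module.span (vscale K) BM = M"
        using fin_dim_basis[OF cM dim(3)[OF K]] by auto
      obtain BD where BD: "finite BD" "module.span (\<lambda>c f x y. c * f x y) BD = D"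
        using fin_dim_basis[OF cD fD] by auto
      have "vspace_iso (sub_vspace K M) ?D"
        by (rule vspace_iso_of_dim_eq[OF cM cD BM(1) _ BD(1)]) (simp_all add: BM(2) BD(2) eq)
      then show ?thesis using vspace_iso_trans DH(1) by blast
    qed
    ultimately show ?thesis by blast
  qed
  ultimately show ?thesis by blast
qed

end
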